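(* Let $\nu\geq 2$ be an integer, let $\mathbf{c}=(c_\nu,c_{\nu-1},\ldots,c_1)\in\mathbb{Z}^{\nu}$ be a fixed non-zero vector, and let $P(x)=c_{\nu}x^{\nu}+c_{\nu-1}x^{\nu-1}+\cdots+c_1x$ have non-zero discriminant. Let $J$ be the number of distinct irreducible factors of $P(x)$ in $\mathbb{Z}[x]$. Then for all $Q\geq 1$, \[\frac{1}{Q}\ll D_{\mathcal{N}_{Q,P}}(\mathcal{F}_{Q,P})\ll\frac{(\log Q)^J}{Q},\] where the implied constants depend on $P$.
   Context: For a positive integer $Q$, $\mathcal{F}_{Q,P}=\{a/q: 1\leq a\leq q\leq Q,\ \gcd(P(a),q)=1\}\subset(0,1]$ (polynomial Farey fractions), and $\mathcal{N}_{Q,P}=\#\mathcal{F}_{Q,P}$. For a finite set of $N$ points $x_1,\dots,x_N$ in $[0,1]$, for $\alpha\in[0,1]$ let $A(\alpha;N)$ be the number of points not exceeding $\alpha$, $R_N(\alpha)=|A(\alpha;N)/N-\alpha|$, and the discrepancy is $D_N=\sup_{0\le\alpha\le1}R_N(\alpha)$; $D_{\mathcal{N}_{Q,P}}(\mathcal{F}_{Q,P})$ is the discrepancy of the points of $\mathcal{F}_{Q,P}$.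
   Formalization: The upper bound is stated for Q ≥ 2 only, since at Q = 1 the discrepancy is 1 while (log 1)^J/1 = 0 (J ≥ 1 because x divides P); J counts irreducible factors of positive degree up to sign, which gives a bound at least as strong. *)

theory Defs
  imports
    Complex_Main
    "HOL-Computational_Algebra.Polynomial_Factorial"
    "Subresultants.Resultant_Prelim"
begin

definition poly_farey :: "int poly \<Rightarrow> nat \<Rightarrow> real set" where
  "poly_farey P Q =
     {real a / real q | a q. 1 \<le> a \<and> a \<le> q \<and> q \<le> Q \<and> gcd (poly P (int a)) (int q) = 1}"

definition discrepancy :: "real set \<Rightarrow> real" where
  "discrepancy S =
     (SUP \<alpha>\<in>{0..1}. \<bar>real (card {x \<in> S. x \<le> \<alpha>}) / real (card S) - \<alpha>\<bar>)"

text \<open>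
  The classical formula \<open>(-1)\<^bsup>n(n-1)/2\<^esup> Res(f, f') / a\<^sub>n\<close> with \<open>n = deg f\<close> and \<open>a\<^sub>n\<close> the leading
  coefficient. For \<open>n \<ge> 1\<close> the division is exact: the first column of the Sylvester matrix of
  \<open>f\<close> and \<open>f'\<close> has no non-zero entries besides \<open>a\<^sub>n\<close> and \<open>n a\<^sub>n\<close>.
\<close>

definition discriminant :: "int poly \<Rightarrow> int" where
  "discriminant f =
     (-1) ^ (degree f * (degree f - 1) div 2) * resultant f (pderiv f) div lead_coeff f"

text \<open>
  Irreducible factors of positive degree, counted up to the units \<open>\<plusminus>1\<close> of \<open>\<int>[x]\<close> (a normalized
  integer polynomial is one with positive leading coefficient). Prime numbers dividing the
  content of \<open>f\<close> are not counted.
\<close>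

definition num_irreducible_factors :: "int poly \<Rightarrow> nat" where
  "num_irreducible_factors f =
     card {g. irreducible g \<and> 0 < degree g \<and> normalize g = g \<and> g dvd f}"

end

theory Submission
  imports
    Defs
    "HOL-Computational_Algebra.Nth_Powers"
    "HOL-Computational_Algebra.Squarefree"
    "HOL-Library.FuncSet"
    "HOL-Real_Asymp.Real_Asymp"
    "Subresultants.Subresultant_Gcd"
begin

text \<open>
  Every fraction is at least \<open>1/Q\<close>, which gives the lower bound. Since \<open>x\<close> divides \<open>P\<close>, the
  fractions are in lowest terms, so the counting function is a sum over \<open>q \<le> Q\<close>. Inclusion-exclusion
  over the primes dividing \<open>q\<close> bounds its deviation by \<open>Q\<close> times the sum of \<open>\<rho>\<^sub>P(d)/d\<close> over squarefree
  \<open>d \<le> Q\<close>, where \<open>\<rho>\<^sub>P(d)\<close> is the number of roots of \<open>P\<close> modulo \<open>d\<close>. This sum is submultiplicative in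
  \<open>P\<close> and depends only on the distinct irreducible factors of \<open>P\<close>. A constant factor contributes \<open>O(1)\<close>.
  An irreducible \<open>g\<close> of degree \<open>n > 0\<close> contributes \<open>O(log Q)\<close>, because \<open>\<Sum> \<rho>\<^sub>g(d) = O(x)\<close> over the
  squarefree \<open>d \<in> (x, 2x]\<close>: by the pigeonhole principle, a root \<open>r\<close> of \<open>g\<close> modulo \<open>d\<close> is also a root
  modulo \<open>d\<close> of a nonzero polynomial \<open>h\<close> of degree below \<open>n\<close> with coefficients of size \<open>d\<^bsup>1/n\<^esup>\<close>. The
  resultant of \<open>g\<close> and \<open>h\<close> is then a bounded multiple of \<open>d\<close>, and modulo a prime that divides it only
  once \<open>g\<close> and \<open>h\<close> have just one common root, so each \<open>h\<close> arises from boundedly many pairs \<open>(d, r)\<close>.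
  Finally, there are at least \<open>c Q\<^sup>2\<close> fractions, by sieving the denominators in a progression
  \<open>1 mod M\<close> where \<open>M\<close> is divisible by all small primes.
\<close>

section \<open>Divisibility and size of resultants\<close>

lemma prod_dvd_det_if_columns_dvd:
  fixes A :: "'a :: comm_ring_1 mat"
  assumes A: "A \<in> carrier_mat n n"
    and dvd: "\<And>i j. i < n \<Longrightarrow> j < n \<Longrightarrow> c j dvd A $$ (i, j)"
  shows "(\<Prod>j<n. c j) dvd det A"
proof -
  have "(\<Prod>j<n. c j) dvd (\<Prod>i=0..<n. A $$ (i, \<sigma> i))" if \<sigma>: "\<sigma> permutes {0..<n}" for \<sigma>
  proof -
    have "(\<Prod>j<n. c j) = (\<Prod>i=0..<n. c (\<sigma> i))"
      using prod.permute[OF \<sigma>, of c] by (simp add: lessThan_atLeast0 comp_def)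
    also have "\<dots> dvd (\<Prod>i=0..<n. A $$ (i, \<sigma> i))"
      using permutes_in_image[OF \<sigma>] by (intro prod_dvd_prod dvd) auto
    finally show ?thesis .
  qed
  then show ?thesis
    unfolding det_def'[OF A] by (intro dvd_sum dvd_mult) auto
qed

lemma abs_det_le:
  fixes A :: "'a :: linordered_idom mat"
  assumes A: "A \<in> carrier_mat n n"
    and le: "\<And>i j. i < n \<Longrightarrow> j < n \<Longrightarrow> \<bar>A $$ (i, j)\<bar> \<le> b i"
  shows "\<bar>det A\<bar> \<le> fact n * (\<Prod>i<n. b i)"
proof -
  have "\<bar>signof \<sigma> * (\<Prod>i=0..<n. A $$ (i, \<sigma> i))\<bar> \<le> (\<Prod>i<n. b i)"
    if \<sigma>: "\<sigma> permutes {0..<n}" for \<sigma>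
  proof -
    have "\<bar>signof \<sigma> * (\<Prod>i=0..<n. A $$ (i, \<sigma> i))\<bar> = (\<Prod>i=0..<n. \<bar>A $$ (i, \<sigma> i)\<bar>)"
      by (simp add: abs_mult abs_prod sign_def)
    also have "\<dots> \<le> (\<Prod>i=0..<n. b i)"
      using permutes_in_image[OF \<sigma>] by (intro prod_mono conjI le) auto
    finally show ?thesis by (simp add: lessThan_atLeast0)
  qed
  then have "\<bar>det A\<bar> \<le> (\<Sum>\<sigma> | \<sigma> permutes {0..<n}. \<Prod>i<n. b i)"
    unfolding det_def'[OF A] by (intro order_trans[OF sum_abs] sum_mono) auto
  then show ?thesis by (simp add: card_permutations[of _ n])
qed

lemma mult_dvd_diff_mult_det:
  fixes A :: "'a :: comm_ring_1 mat"
  assumes A: "A \<in> carrier_mat n n" and "2 \<le> n"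
    and d: "\<And>i. i < n \<Longrightarrow> d dvd (\<Sum>j<n. A $$ (i, j) * r ^ (n - Suc j))"
    and e: "\<And>i. i < n \<Longrightarrow> e dvd (\<Sum>j<n. A $$ (i, j) * (s ^ (n - Suc j) - r ^ (n - Suc j)))"
  shows "d * e dvd (s - r) * det A"
proof -
  obtain m where n: "n = Suc (Suc m)" using \<open>2 \<le> n\<close> by (metis add_2_eq_Suc le_Suc_ex)
  \<comment> \<open>\<open>A * U\<close> has the row values at \<open>r\<close> and their differences between \<open>s\<close> and \<open>r\<close> as last two columns.\<close>
  define U where "U = mat n n (\<lambda>(j, k). if k = Suc m then r ^ (n - Suc j)
      else if k = m then s ^ (n - Suc j) - r ^ (n - Suc j) else if j = k then 1 else 0)"
  have U: "U \<in> carrier_mat n n" by (simp add: U_def)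
  have "upper_triangular U" by (auto simp: upper_triangular_def U_def n)
  then have "det U = (\<Prod>i<n. U $$ (i, i))"
    using U by (simp add: det_upper_triangular[OF _ U] prod_list_diag_prod lessThan_atLeast0)
  also have "\<dots> = s - r" by (simp add: n U_def)
  finally have "det (A * U) = (s - r) * det A" by (simp add: det_mult[OF A U] mult.commute)
  moreover have "(\<Prod>k<n. if k = Suc m then d else if k = m then e else 1) dvd det (A * U)"
  proof (rule prod_dvd_det_if_columns_dvd[OF mult_carrier_mat[OF A U]])
    fix i k assume "i < n" "k < n"
    then have "(A * U) $$ (i, k) = (\<Sum>j<n. A $$ (i, j) * U $$ (j, k))"
      using A U by (simp add: scalar_prod_def lessThan_atLeast0)
    then show "(if k = Suc m then d else if k = m then e else 1) dvd (A * U) $$ (i, k)"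
      using d[OF \<open>i < n\<close>] e[OF \<open>i < n\<close>] \<open>k < n\<close> by (simp add: U_def)
  qed
  moreover have "(\<Prod>k<n. if k = Suc m then d else if k = m then e else 1) = d * e"
    by (simp add: n mult.commute)
  ultimately show ?thesis by simp
qed

lemma sum_sylvester_mat_mult_powers:
  fixes f g :: "'a :: comm_ring_1 poly"
  defines "m \<equiv> degree f" and "n \<equiv> degree g"
  assumes i: "i < m + n"
  shows "(\<Sum>j<m + n. sylvester_mat f g $$ (i, j) * x ^ (m + n - Suc j)) =
    (if i < n then x ^ (n - Suc i) * poly f x else x ^ (m + n - Suc i) * poly g x)"
proof -
  define h where "h = (if i < n then monom 1 (n - Suc i) * f else monom 1 (m + n - Suc i) * g)"
  have "degree (monom 1 k * p :: 'a poly) \<le> k + degree p" for k p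
    by (rule order_trans[OF degree_mult_le]) (simp add: degree_monom_le)
  from this[of "n - Suc i" f] this[of "m + n - Suc i" g] have deg: "degree h < m + n"
    using i by (auto simp: h_def m_def n_def)
  have "sylvester_mat f g $$ (i, j) = coeff h (m + n - Suc j)" if "j < m + n" for j
  proof -
    have "m + n - j = Suc (m + n - Suc j)" "m + n - i = Suc (m + n - Suc i)"
      "i < n \<Longrightarrow> n - i = Suc (n - Suc i)"
      using i that by simp_all
    then show ?thesis
      using sylvester_index_mat2[of i f g j, folded m_def n_def] i that
      by (cases "i < n")
        (simp_all only: h_def coeff_monom_mult if_True if_False Suc_le_mono diff_Suc_Suc)
  qed
  then have "(\<Sum>j<m + n. sylvester_mat f g $$ (i, j) * x ^ (m + n - Suc j)) =
      (\<Sum>j<m + n. coeff h (m + n - Suc j) * x ^ (m + n - Suc j))"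
    by simp
  also have "\<dots> = (\<Sum>j<m + n. coeff h j * x ^ j)"
    by (rule sum.nat_diff_reindex)
  also have "\<dots> = poly h x"
    unfolding poly_altdef using deg by (intro sum.mono_neutral_right) (auto simp: coeff_eq_0)
  finally show ?thesis by (simp add: h_def poly_monom)
qed

lemma mult_dvd_diff_mult_resultant:
  fixes f g :: "'a :: comm_ring_1 poly"
  defines "N \<equiv> degree f + degree g"
  assumes "2 \<le> N" and d: "d dvd poly f r" "d dvd poly g r"
    and r: "e dvd poly f r" "e dvd poly g r" and s: "e dvd poly f s" "e dvd poly g s"
  shows "d * e dvd (s - r) * resultant f g"
  unfolding resultant_def
proof (rule mult_dvd_diff_mult_det[OF sylvester_carrier_mat[of f g, folded N_def] \<open>2 \<le> N\<close>])
  fix i assume "i < N"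
  note row = sum_sylvester_mat_mult_powers[of i f g, folded N_def, OF this]
  show "d dvd (\<Sum>j<N. sylvester_mat f g $$ (i, j) * r ^ (N - Suc j))"
    unfolding row using d by simp
  show "e dvd (\<Sum>j<N. sylvester_mat f g $$ (i, j) * (s ^ (N - Suc j) - r ^ (N - Suc j)))"
    unfolding right_diff_distrib sum_subtractf row using r s by (simp add: dvd_diff)
qed

lemma dvd_resultant_if_common_root:
  fixes f g :: "'a :: comm_ring_1 poly"
  assumes "0 < degree f" "d dvd poly f r" "d dvd poly g r"
  shows "d dvd resultant f g"
proof (cases "degree g")
  case 0
  then obtain a where "g = [:a:]" by (rule degree_eq_zeroE)
  with assms show ?thesis by (auto intro: dvd_trans dvd_power)
next
  case (Suc k)
  with assms have "d * 1 dvd (r + 1 - r) * resultant f g"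
    by (intro mult_dvd_diff_mult_resultant) auto
  then show ?thesis by simp
qed

text \<open>The factor \<open>lc(f)\<close> matters only for linear \<open>f\<close> and constant \<open>g\<close>, where the Sylvester matrix has
  just one column.\<close>

lemma prime_square_dvd_lead_coeff_mult_resultant:
  fixes f g :: "'a :: factorial_ring_gcd poly"
  assumes p: "prime p" "\<not> p dvd s - r" and "0 < degree f"
    and r: "p dvd poly f r" "p dvd poly g r" and s: "p dvd poly f s" "p dvd poly g s"
  shows "p\<^sup>2 dvd lead_coeff f * resultant f g"
proof (cases "2 \<le> degree f + degree g")
  case True
  then have "p * p dvd (s - r) * resultant f g"
    using r s by (intro mult_dvd_diff_mult_resultant)
  moreover have "coprime (p\<^sup>2) (s - r)" using p by (simp add: prime_imp_coprime)
  ultimately show ?thesis by (simp add: power2_eq_square coprime_dvd_mult_right_iff)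
next
  case False
  with \<open>0 < degree f\<close> have "degree f = 1" "degree g = 0" by auto
  then obtain a b c where f: "f = [:b, a:]" and g: "g = [:c:]"
    by (metis One_nat_def degree_eq_zeroE degree_pCons_eq_if nat.inject old.nat.distinct(1)
        pCons_cases)
  have "p dvd poly f s - poly f r" using r s by simp
  then have "p dvd a * (s - r)" by (simp add: f algebra_simps)
  then have "p dvd a" using p by (simp add: prime_dvd_mult_iff)
  moreover have "p dvd c" using r by (simp add: g)
  ultimately show ?thesis using \<open>degree f = 1\<close> by (simp add: f g power2_eq_square mult_dvd_mono)
qed

lemma abs_resultant_le:
  fixes f g :: "'a :: linordered_idom poly"
  assumes f: "\<And>i. \<bar>coeff f i\<bar> \<le> F" and g: "\<And>i. \<bar>coeff g i\<bar> \<le> G"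
  shows "\<bar>resultant f g\<bar> \<le> fact (degree f + degree g) * F ^ degree g * G ^ degree f"
proof -
  have "0 \<le> F" "0 \<le> G" using f[of 0] g[of 0] by linarith+
  then have "\<bar>resultant f g\<bar> \<le> fact (degree f + degree g) *
      (\<Prod>i<degree f + degree g. if i < degree g then F else G)"
    unfolding resultant_def using f g
    by (intro abs_det_le sylvester_carrier_mat) (auto simp: sylvester_index_mat)
  also have "(\<Prod>i<degree f + degree g. if i < degree g then F else G) = F ^ degree g * G ^ degree f"
  proof -
    have "{..<degree f + degree g} \<inter> {i. i < degree g} = {..<degree g}"
      "{..<degree f + degree g} \<inter> - {i. i < degree g} = {degree g..<degree f + degree g}"
      by auto
    then show ?thesis by (simp add: prod.If_cases)
  qed
  finally show ?thesis by (simp add: mult.assoc)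
qed

lemma resultant_ne_0_if_degree_less:
  fixes f g :: "'a :: {factorial_ring_gcd, semiring_gcd_mult_normalize} poly"
  assumes "irreducible f" "degree g < degree f" "g \<noteq> 0"
  shows "resultant f g \<noteq> 0"
proof
  assume "resultant f g = 0"
  then have "\<not> is_unit (gcd f g)" by (metis resultant_0_gcd is_unit_polyE degree_pCons_0)
  with \<open>irreducible f\<close> have "f dvd gcd f g" by (metis gcd_dvd1 irreducibleD')
  then have "f dvd g" by simp
  with assms show False using dvd_imp_degree_le[of f g] by simp
qed

section \<open>Roots of an irreducible polynomial modulo squarefree numbers\<close>

lemma squarefree_dvdI:
  fixes d z :: "'a :: factorial_semiring"
  assumes d: "squarefree d" and dvd: "\<And>p. prime p \<Longrightarrow> p dvd d \<Longrightarrow> p dvd z"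
  shows "d dvd z"
proof (cases "z = 0")
  case False
  have "d \<noteq> 0" using d by auto
  then show ?thesis
  proof (rule multiplicity_le_imp_dvd)
    fix p :: 'a assume "prime p"
    show "multiplicity p d \<le> multiplicity p z"
    proof (cases "p dvd d")
      case True
      have "multiplicity p d \<le> 1"
        using d \<open>prime p\<close> \<open>d \<noteq> 0\<close> by (simp add: squarefree_factorial_semiring'')
      also have "1 \<le> multiplicity p z"
        using dvd[OF \<open>prime p\<close> True] \<open>prime p\<close> False by (intro multiplicity_geI) auto
      finally show ?thesis .
    qed (simp add: not_dvd_imp_multiplicity_0)
  qed
qed simp

lemma coprime_if_squarefree_mult:
  fixes a b :: "'a :: algebraic_semidom"
  assumes "squarefree (a * b)"
  shows "coprime a b"
proof (rule coprimeI)
  fix c assume "c dvd a" "c dvd b"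
  then have "c\<^sup>2 dvd a * b" by (simp add: power2_eq_square mult_dvd_mono)
  with assms show "is_unit c" by (rule squarefreeD)
qed

lemma dvd_diff_if_common_roots:
  fixes f g :: "'a :: factorial_ring_gcd poly"
  assumes d: "squarefree d" and "0 < degree f"
    and r: "d dvd poly f r" "d dvd poly g r" and s: "d dvd poly f s" "d dvd poly g s"
    and m: "lead_coeff f * resultant f g = d * m" "m dvd s - r"
  shows "d dvd s - r"
proof (rule squarefree_dvdI[OF d], rule ccontr)
  fix p assume p: "prime p" "p dvd d" "\<not> p dvd s - r"
  obtain k where k: "d = p * k" using p(2) by blast
  have "p\<^sup>2 dvd d * m"
    unfolding m(1)[symmetric] using \<open>0 < degree f\<close> p r s
    by (intro prime_square_dvd_lead_coeff_mult_resultant[of p s r]) (auto intro: dvd_trans)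
  then have "p dvd k * m"
    using \<open>prime p\<close> by (auto simp: k power2_eq_square mult.assoc)
  moreover have "coprime p k"
    using d coprime_if_squarefree_mult unfolding k by blast
  ultimately have "p dvd m" by (simp add: coprime_dvd_mult_right_iff)
  with m(2) p(3) show False by (blast intro: dvd_trans)
qed

lemma diff_dvd_poly_diff:
  fixes p :: "'a :: comm_ring_1 poly"
  shows "x - y dvd poly p x - poly p y"
proof -
  have "poly p x = poly ([:- y, 1:] * synthetic_div p y + [:poly p y:]) x"
    by (simp only: synthetic_div_correct')
  then have "poly p x - poly p y = (x - y) * poly (synthetic_div p y) x"
    by (simp add: algebra_simps)
  then show ?thesis by simp
qed

lemma dvd_poly_mod_iff:
  fixes a d :: "'a :: euclidean_ring_cancel"
  shows "d dvd poly P (a mod d) \<longleftrightarrow> d dvd poly P a"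
proof -
  have "d dvd a mod d - a" by (simp flip: mod_eq_dvd_iff)
  then have "d dvd poly P (a mod d) - poly P a" using diff_dvd_poly_diff dvd_trans by blast
  then show ?thesis
    using dvd_add_right_iff[of d "poly P (a mod d) - poly P a" "poly P a"] by simp
qed

definition roots_mod :: "int poly \<Rightarrow> int \<Rightarrow> int set" where
  "roots_mod P d = {r \<in> {0..<d}. d dvd poly P r}"

lemma finite_roots_mod [simp]: "finite (roots_mod P d)"
  by (rule finite_subset[of _ "{0..<d}"]) (auto simp: roots_mod_def)

lemma mod_in_roots_mod_iff: "0 < d \<Longrightarrow> a mod d \<in> roots_mod P d \<longleftrightarrow> d dvd poly P a"
  by (simp add: roots_mod_def dvd_poly_mod_iff)

lemma roots_mod_eqI:
  assumes "r \<in> roots_mod P d" "s \<in> roots_mod P d" "d dvd r - s"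
  shows "r = s"
proof -
  have "r mod d = s mod d" using assms(3) by (simp add: mod_eq_dvd_iff)
  then show ?thesis using assms(1,2) by (simp add: roots_mod_def)
qed

definition common_roots_above :: "int \<Rightarrow> int poly \<Rightarrow> int poly \<Rightarrow> (int \<times> int) set" where
  "common_roots_above x f g = {(d, r). x < d \<and> squarefree d \<and> r \<in> roots_mod f d \<and> d dvd poly g r}"

lemma abs_div_le_if_dvd:
  fixes d x K R :: int
  assumes "d dvd R" "0 < x" "x < d" "\<bar>R\<bar> \<le> K * x"
  shows "\<bar>R div d\<bar> \<le> K"
proof -
  have "x * \<bar>R div d\<bar> \<le> d * \<bar>R div d\<bar>" using assms(3) by (intro mult_right_mono) auto
  also have "\<dots> = \<bar>d * (R div d)\<bar>" using assms(2,3) by (simp add: abs_mult)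
  also have "\<dots> \<le> K * x" using assms(1,4) by simp
  finally show ?thesis using assms(2) by (simp add: mult.commute)
qed

text \<open>If \<open>f\<close> and \<open>g\<close> share the root \<open>r\<close> modulo \<open>d\<close>, then \<open>lc(f) Res(f, g)\<close> is a multiple \<open>d m\<close>
  of \<open>d\<close>, and both \<open>d\<close> and \<open>r\<close> can be recovered from \<open>m\<close> and \<open>r mod m\<close>.\<close>

lemma
  fixes f g :: "int poly" and x K :: int
  assumes deg: "0 < degree f" and "0 < x"
    and R: "resultant f g \<noteq> 0" "\<bar>lead_coeff f * resultant f g\<bar> \<le> K * x"
  shows finite_common_roots_above: "finite (common_roots_above x f g)"
    and card_common_roots_above_le: "card (common_roots_above x f g) \<le> nat ((2 * K + 1) * K)"
proof -
  let ?S = "common_roots_above x f g" and ?R = "lead_coeff f * resultant f g"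
  define m where "m d = ?R div d" for d
  define \<phi> where "\<phi> = (\<lambda>(d, r). (m d, r mod \<bar>m d\<bar>))"
  have R_eq: "?R = d * m d" if "(d, r) \<in> ?S" for d r
    using that dvd_resultant_if_common_root[OF deg, of d r g]
    by (simp add: common_roots_above_def roots_mod_def m_def)
  have m: "m d \<noteq> 0" "\<bar>m d\<bar> \<le> K" if "(d, r) \<in> ?S" for d r
    using R_eq[OF that] R deg abs_div_le_if_dvd[of d ?R x K] \<open>0 < x\<close> that
    by (auto simp: m_def common_roots_above_def intro: dvdI)
  have inj: "inj_on \<phi> ?S"
  proof (rule inj_onI, clarify)
    fix d r d' r' assume dr: "(d, r) \<in> ?S" and dr': "(d', r') \<in> ?S" and eq: "\<phi> (d, r) = \<phi> (d', r')"
    then have "m d = m d'" by (simp add: \<phi>_def)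
    then have "d' * m d = d * m d" by (metis R_eq[OF dr] R_eq[OF dr'])
    then have [simp]: "d' = d" using m(1)[OF dr] by simp
    have "m d dvd r - r'" using eq by (simp add: \<phi>_def mod_eq_dvd_iff)
    then have "d dvd r - r'"
      using dr dr' deg R_eq[OF dr]
      by (intro dvd_diff_if_common_roots[of d f r' g r "m d"])
        (auto simp: common_roots_above_def roots_mod_def)
    then show "d = d' \<and> r = r'" using dr dr' roots_mod_eqI by (auto simp: common_roots_above_def)
  qed
  have sub: "\<phi> ` ?S \<subseteq> {- K..K} \<times> {0..<K}"
  proof (rule image_subsetI)
    fix s assume "s \<in> ?S"
    moreover obtain d r where s: "s = (d, r)" by force
    ultimately have dr: "(d, r) \<in> ?S" by simp
    have "0 < \<bar>m d\<bar>" using m(1)[OF dr] by simp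
    then have "0 \<le> r mod \<bar>m d\<bar>" "r mod \<bar>m d\<bar> < \<bar>m d\<bar>" by simp_all
    then show "\<phi> s \<in> {- K..K} \<times> {0..<K}" using m(2)[OF dr] by (auto simp: s \<phi>_def)
  qed
  show "finite ?S" by (rule inj_on_finite[OF inj sub]) simp
  have "0 \<le> K * x" using R(2) by linarith
  then have "0 \<le> K" using \<open>0 < x\<close> by (simp add: zero_le_mult_iff)
  moreover have "card ?S \<le> card ({- K..K} \<times> {0..<K})" by (rule card_inj_on_le[OF inj sub]) simp
  ultimately show "card ?S \<le> nat ((2 * K + 1) * K)"
    by (simp add: card_cartesian_product nat_mult_distrib add.commute)
qed

definition small_polys :: "nat \<Rightarrow> nat \<Rightarrow> int poly set" where
  "small_polys n L = {h. degree h < n \<and> (\<forall>i. \<bar>coeff h i\<bar> \<le> int L)}"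

lemma finite_small_polys: "finite (small_polys n L)" (is ?fin)
  and card_small_polys_le: "card (small_polys n L) \<le> (2 * L + 1) ^ n" (is ?card)
proof -
  define Y where "Y = PiE {..<n} (\<lambda>_. {- int L..int L})"
  have Y: "finite Y" "card Y = (2 * L + 1) ^ n"
    by (simp_all add: Y_def finite_PiE card_PiE nat_add_distrib nat_mult_distrib)
  have inj: "inj_on (\<lambda>h. restrict (coeff h) {..<n}) (small_polys n L)"
  proof (rule inj_onI)
    fix h k assume hk: "h \<in> small_polys n L" "k \<in> small_polys n L"
      and eq: "restrict (coeff h) {..<n} = restrict (coeff k) {..<n}"
    show "h = k"
    proof (rule poly_eqI)
      fix i
      show "coeff h i = coeff k i"
        using hk fun_cong[OF eq, of i] by (cases "i < n") (auto simp: small_polys_def coeff_eq_0)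
    qed
  qed
  have sub: "(\<lambda>h. restrict (coeff h) {..<n}) ` small_polys n L \<subseteq> Y"
    unfolding Y_def
    by (rule image_subsetI) (auto simp: small_polys_def abs_le_iff minus_le_iff restrict_PiE_iff)
  show ?fin by (rule inj_on_finite[OF inj sub Y(1)])
  show ?card using card_inj_on_le[OF inj sub Y(1)] Y(2) by simp
qed

lemma ex_small_poly_dvd:
  fixes d r :: int
  assumes d: "0 < d" "d < int ((L + 1) ^ n)"
  shows "\<exists>h\<in>small_polys n L. h \<noteq> 0 \<and> d dvd poly h r"
proof -
  define X where "X = PiE {..<n} (\<lambda>_. {0..int L})"
  define poly_of :: "(nat \<Rightarrow> int) \<Rightarrow> int poly" where "poly_of a = (\<Sum>i<n. monom (a i) i)" for a
  have coeff: "coeff (poly_of a) i = (if i < n then a i else 0)" for a i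
    by (simp add: poly_of_def coeff_sum)
  have "card ((\<lambda>a. poly (poly_of a) r mod d) ` X) \<le> card {0..<d}"
    using d by (intro card_mono) auto
  also have "\<dots> < card X"
    using d by (simp add: X_def card_PiE nat_less_iff nat_add_distrib)
  finally have "\<not> inj_on (\<lambda>a. poly (poly_of a) r mod d) X" by (rule pigeonhole)
  then obtain a b where ab: "a \<in> X" "b \<in> X" "a \<noteq> b"
    and eq: "poly (poly_of a) r mod d = poly (poly_of b) r mod d"
    by (auto simp: inj_on_def)
  define h where "h = poly_of a - poly_of b"
  have "h \<noteq> 0"
  proof
    assume "h = 0"
    then have "a i = b i" if "i < n" for i
      using coeff[of a i] coeff[of b i] that by (simp add: h_def)
    then have "a = b" using ab(1,2) unfolding X_def by (intro PiE_ext) auto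
    with \<open>a \<noteq> b\<close> show False ..
  qed
  moreover have "degree h < n"
    using \<open>h \<noteq> 0\<close> coeff by (metis coeff_diff diff_0 h_def leading_coeff_0_iff minus_zero)
  moreover have "\<bar>coeff h i\<bar> \<le> int L" for i
  proof (cases "i < n")
    case True
    then have "a i \<in> {0..int L}" "b i \<in> {0..int L}"
      using ab unfolding X_def by (blast dest: PiE_mem)+
    then show ?thesis using True by (auto simp: h_def coeff)
  qed (simp add: h_def coeff)
  moreover have "d dvd poly h r" using eq by (simp add: h_def mod_eq_dvd_iff)
  ultimately show ?thesis by (auto simp: small_polys_def)
qed

lemma ex_resultant_small_polys_bound:
  fixes g :: "int poly"
  shows "\<exists>K\<ge>0. \<forall>L. \<forall>h\<in>small_polys (degree g) L. \<bar>resultant g h\<bar> \<le> K * int L ^ degree g"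
proof -
  define n where "n = degree g"
  define G where "G = 1 + (\<Sum>i\<le>n. \<bar>coeff g i\<bar>)"
  have "1 \<le> G" by (simp add: G_def sum_nonneg)
  have G: "\<bar>coeff g i\<bar> \<le> G" for i
  proof (cases "i \<le> n")
    case True
    then have "\<bar>coeff g i\<bar> \<le> (\<Sum>i\<le>n. \<bar>coeff g i\<bar>)" by (intro member_le_sum) auto
    then show ?thesis by (simp add: G_def)
  qed (use \<open>1 \<le> G\<close> in \<open>simp add: n_def coeff_eq_0\<close>)
  have "\<bar>resultant g h\<bar> \<le> fact (2 * n) * G ^ n * int L ^ n" if h: "h \<in> small_polys n L" for L h
  proof -
    have "\<bar>resultant g h\<bar> \<le> fact (n + degree h) * G ^ degree h * int L ^ n"
      unfolding n_def using G h by (intro abs_resultant_le) (auto simp: small_polys_def)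
    also have "\<dots> \<le> fact (2 * n) * G ^ n * int L ^ n"
      using h \<open>1 \<le> G\<close>
      by (intro mult_right_mono mult_mono fact_mono power_increasing) (auto simp: small_polys_def)
    finally show ?thesis .
  qed
  then show ?thesis
    unfolding n_def[symmetric] using \<open>1 \<le> G\<close> by (intro exI[of _ "fact (2 * n) * G ^ n"]) auto
qed

lemma card_common_roots_above_small_poly_le:
  fixes g :: "int poly"
  assumes irr: "irreducible g" and deg: "0 < degree g"
  shows "\<exists>B. \<forall>x L. \<forall>h\<in>small_polys (degree g) L - {0}. 1 \<le> x \<longrightarrow> L ^ degree g \<le> 2 * x \<longrightarrow>
    finite (common_roots_above (int x) g h) \<and> card (common_roots_above (int x) g h) \<le> B"
proof -
  obtain K where "0 \<le> K"
    and K: "\<And>L h. h \<in> small_polys (degree g) L \<Longrightarrow> \<bar>resultant g h\<bar> \<le> K * int L ^ degree g"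
    using ex_resultant_small_polys_bound by blast
  define M where "M = 2 * \<bar>lead_coeff g\<bar> * K"
  have "finite (common_roots_above (int x) g h) \<and>
      card (common_roots_above (int x) g h) \<le> nat ((2 * M + 1) * M)"
    if "1 \<le> x" and L: "L ^ degree g \<le> 2 * x" and h: "h \<in> small_polys (degree g) L - {0}" for x L h
  proof -
    have "resultant g h \<noteq> 0"
      using h by (intro resultant_ne_0_if_degree_less irr) (auto simp: small_polys_def)
    moreover have "\<bar>lead_coeff g * resultant g h\<bar> \<le> M * int x"
    proof -
      have "\<bar>resultant g h\<bar> \<le> K * int L ^ degree g" using K h by simp
      also have "\<dots> \<le> K * int (2 * x)"
        using L \<open>0 \<le> K\<close> by (intro mult_left_mono) (simp_all flip: of_nat_power)
      finally have "\<bar>lead_coeff g\<bar> * \<bar>resultant g h\<bar> \<le> \<bar>lead_coeff g\<bar> * (K * int (2 * x))"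
        by (intro mult_left_mono) auto
      then show ?thesis by (simp add: abs_mult M_def mult_ac)
    qed
    ultimately show ?thesis
      using deg \<open>1 \<le> x\<close> by (auto intro: finite_common_roots_above card_common_roots_above_le)
  qed
  then show ?thesis by blast
qed

lemma squarefree_roots_subset_common_roots:
  assumes "2 * x < (L + 1) ^ n"
  shows "Sigma {d. d \<in> {int x<..2 * int x} \<and> squarefree d} (roots_mod g) \<subseteq>
    (\<Union>h\<in>small_polys n L - {0}. common_roots_above (int x) g h)"
proof clarify
  fix d r assume d: "d \<in> {int x<..2 * int x}" "squarefree d" and r: "r \<in> roots_mod g d"
  have "int (2 * x) < int ((L + 1) ^ n)" using assms by (simp only: of_nat_less_iff)
  then have "0 < d" "d < int ((L + 1) ^ n)" using d(1) by auto
  then obtain h where "h \<in> small_polys n L - {0}" "d dvd poly h r"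
    using ex_small_poly_dvd[of d L n r] by auto
  then show "(d, r) \<in> (\<Union>h\<in>small_polys n L - {0}. common_roots_above (int x) g h)"
    using d r by (auto simp: common_roots_above_def)
qed

lemma sum_card_roots_mod_dyadic_le:
  fixes g :: "int poly"
  assumes irr: "irreducible g" and deg: "0 < degree g"
  shows "\<exists>C. \<forall>x\<ge>1. (\<Sum>d | d \<in> {int x<..2 * int x} \<and> squarefree d. card (roots_mod g d)) \<le> C * x"
proof -
  define n where "n = degree g"
  have "0 < n" using deg by (simp add: n_def)
  obtain B where B: "finite (common_roots_above (int x) g h)"
      "card (common_roots_above (int x) g h) \<le> B"
    if "1 \<le> x" "L ^ n \<le> 2 * x" "h \<in> small_polys n L - {0}" for x L h
    using card_common_roots_above_small_poly_le[OF irr deg, folded n_def] by blast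
  have "(\<Sum>d | d \<in> {int x<..2 * int x} \<and> squarefree d. card (roots_mod g d)) \<le> 3 ^ n * 2 * B * x"
    if "1 \<le> x" for x
  proof -
    define L where "L = nth_root_nat n (2 * x)"
    have L_le: "L ^ n \<le> 2 * x" unfolding L_def by (rule nth_root_nat_power_le[OF \<open>0 < n\<close>])
    have L_gt: "\<not> (L + 1) ^ n \<le> 2 * x"
      using nth_root_nat_ge[OF \<open>0 < n\<close>, of "L + 1" "2 * x"] by (auto simp: L_def)
    have "1 \<le> L"
      unfolding L_def using \<open>1 \<le> x\<close> by (intro nth_root_nat_ge[OF \<open>0 < n\<close>]) simp
    define D where "D = {d. d \<in> {int x<..2 * int x} \<and> squarefree d}"
    define H where "H = small_polys n L - {0}"
    have "finite D" by (rule finite_subset[of _ "{int x<..2 * int x}"]) (auto simp: D_def)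
    have "finite H" by (simp add: H_def finite_small_polys)
    have "card (Sigma D (roots_mod g)) \<le> card (\<Union>h\<in>H. common_roots_above (int x) g h)"
      using B(1)[OF \<open>1 \<le> x\<close> L_le] \<open>finite H\<close> squarefree_roots_subset_common_roots[of x L n g] L_gt
      unfolding D_def H_def by (intro card_mono finite_UN_I) auto
    also have "\<dots> \<le> (\<Sum>h\<in>H. card (common_roots_above (int x) g h))"
      by (rule card_UN_le[OF \<open>finite H\<close>])
    also have "\<dots> \<le> card H * B"
      using B(2)[OF \<open>1 \<le> x\<close> L_le]
        sum_bounded_above[of H "\<lambda>h. card (common_roots_above (int x) g h)" B]
      by (simp add: H_def)
    also have "card H \<le> card (small_polys n L)"
      unfolding H_def by (intro card_mono finite_small_polys) auto
    also have "\<dots> \<le> (2 * L + 1) ^ n" by (rule card_small_polys_le)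
    also have "\<dots> \<le> (3 * L) ^ n" using \<open>1 \<le> L\<close> by (intro power_mono) auto
    also have "\<dots> \<le> 3 ^ n * (2 * x)" using L_le by (simp add: power_mult_distrib)
    finally show ?thesis
      using \<open>finite D\<close> by (simp add: card_SigmaI D_def mult_ac)
  qed
  then show ?thesis by blast
qed

section \<open>Logarithmic sums of root counts\<close>

definition squarefree_upto :: "int \<Rightarrow> int set" where
  "squarefree_upto Q = {d \<in> {1..Q}. squarefree d}"

lemma finite_squarefree_upto [simp]: "finite (squarefree_upto Q)"
  by (rule finite_subset[of _ "{1..Q}"]) (auto simp: squarefree_upto_def)

definition root_sum :: "int poly \<Rightarrow> int \<Rightarrow> real" where
  "root_sum P Q = (\<Sum>d\<in>squarefree_upto Q. real (card (roots_mod P d)) / real_of_int d)"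

lemma root_sum_nonneg: "0 \<le> root_sum P Q"
  unfolding root_sum_def by (intro sum_nonneg) (auto simp: squarefree_upto_def)

lemma sum_divide_le_if_dyadic:
  fixes f :: "int \<Rightarrow> real"
  assumes nonneg: "\<And>d. 0 \<le> f d"
    and dyadic: "\<And>k. (\<Sum>d\<in>{2 ^ k<..2 ^ Suc k}. f d) \<le> C * 2 ^ k"
  shows "(\<Sum>d=1..2 ^ k. f d / real_of_int d) \<le> f 1 + C * real k"
proof (induction k)
  case (Suc k)
  have "{1..2 ^ Suc k} = {1..2 ^ k} \<union> {2 ^ k<..2 ^ Suc k :: int}"
    using one_le_power[of "2 :: int" k] by auto
  then have "(\<Sum>d=1..2 ^ Suc k. f d / real_of_int d) =
      (\<Sum>d=1..2 ^ k. f d / real_of_int d) + (\<Sum>d\<in>{2 ^ k<..2 ^ Suc k}. f d / real_of_int d)"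
    by (subst sum.union_disjoint[symmetric]) auto
  also have "(\<Sum>d\<in>{2 ^ k<..2 ^ Suc k}. f d / real_of_int d) \<le> (\<Sum>d\<in>{2 ^ k<..2 ^ Suc k}. f d / 2 ^ k)"
  proof (intro sum_mono divide_left_mono nonneg)
    fix d :: int assume "d \<in> {2 ^ k<..2 ^ Suc k}"
    then have "2 ^ k \<le> d" "0 < d" using zero_less_power[of "2 :: int" k] by simp_all
    then show "2 ^ k \<le> real_of_int d" "0 < real_of_int d * 2 ^ k"
      by (simp_all flip: of_int_le_iff)
  qed
  also have "\<dots> \<le> C" using dyadic[of k] by (simp add: field_simps flip: sum_divide_distrib)
  finally show ?case using Suc by (simp add: algebra_simps)
qed simp

lemma sum_divide_le_ln_if_dyadic:
  fixes f :: "int \<Rightarrow> real"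
  assumes nonneg: "\<And>d. 0 \<le> f d"
    and dyadic: "\<And>k. (\<Sum>d\<in>{2 ^ k<..2 ^ Suc k}. f d) \<le> C * 2 ^ k" and "2 \<le> Q"
  shows "(\<Sum>d=1..Q. f d / real_of_int d) \<le> (f 1 + 2 * C) / ln 2 * ln (real_of_int Q)"
proof -
  have "0 \<le> C" using dyadic[of 0] sum_nonneg[of "{1<..2}" f] nonneg by simp
  define y where "y = log 2 (real_of_int Q)"
  have "1 \<le> y" using \<open>2 \<le> Q\<close> by (simp add: y_def le_log_iff)
  define k where "k = nat \<lceil>y\<rceil>"
  have k: "y \<le> real k" "real k \<le> y + 1" using \<open>1 \<le> y\<close> by (auto simp: k_def)
  have "real_of_int Q = 2 powr y" using \<open>2 \<le> Q\<close> by (simp add: y_def)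
  also have "\<dots> \<le> 2 powr real k" using k(1) by simp
  also have "\<dots> = real_of_int (2 ^ k)" by (simp add: powr_realpow)
  finally have "Q \<le> 2 ^ k" by (simp only: of_int_le_iff)
  then have "(\<Sum>d=1..Q. f d / real_of_int d) \<le> (\<Sum>d=1..2 ^ k. f d / real_of_int d)"
    using nonneg by (intro sum_mono2) auto
  also have "\<dots> \<le> f 1 + C * real k" by (rule sum_divide_le_if_dyadic[OF nonneg dyadic])
  also have "\<dots> \<le> f 1 * y + C * (2 * y)"
    using k(2) \<open>1 \<le> y\<close> \<open>0 \<le> C\<close> nonneg[of 1] mult_left_mono[of 1 y "f 1"]
    by (intro add_mono mult_left_mono) auto
  also have "\<dots> = (f 1 + 2 * C) / ln 2 * ln (real_of_int Q)"
    by (simp add: y_def log_def field_simps)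
  finally show ?thesis .
qed

lemma root_sum_irreducible_le:
  assumes "irreducible g" "0 < degree g"
  shows "\<exists>C\<ge>0. \<forall>Q\<ge>2. root_sum g Q \<le> C * ln (real_of_int Q)"
proof -
  define f where "f d = (if squarefree d then real (card (roots_mod g d)) else 0)" for d
  obtain C where C: "(\<Sum>d | d \<in> {int x<..2 * int x} \<and> squarefree d. card (roots_mod g d)) \<le> C * x"
    if "1 \<le> x" for x
    using sum_card_roots_mod_dyadic_le[OF assms] by blast
  have "(\<Sum>d\<in>{2 ^ k<..2 ^ Suc k}. f d) \<le> real C * 2 ^ k" for k
  proof -
    have "(\<Sum>d\<in>{2 ^ k<..2 ^ Suc k}. f d) =
        real (\<Sum>d | d \<in> {2 ^ k<..2 ^ Suc k} \<and> squarefree d. card (roots_mod g d))"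
      unfolding f_def of_nat_sum by (rule sum.inter_filter[symmetric]) simp
    also have "\<dots> \<le> real (C * 2 ^ k)"
      using C[of "2 ^ k"] by (simp only: of_nat_le_iff) simp
    finally show ?thesis by simp
  qed
  then have "(\<Sum>d=1..Q. f d / real_of_int d) \<le> (f 1 + 2 * real C) / ln 2 * ln (real_of_int Q)"
    if "2 \<le> Q" for Q
    using that by (intro sum_divide_le_ln_if_dyadic) (auto simp: f_def)
  moreover have "root_sum g Q = (\<Sum>d=1..Q. f d / real_of_int d)" for Q
    unfolding root_sum_def squarefree_upto_def sum.inter_filter[OF finite_atLeastAtMost_int]
    by (intro sum.cong) (auto simp: f_def)
  moreover have "0 \<le> (f 1 + 2 * real C) / ln 2" by (simp add: f_def)
  ultimately show ?thesis by (intro exI[of _ "(f 1 + 2 * real C) / ln 2"]) simp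
qed

lemma card_roots_mod_coprime_mult_le:
  assumes "0 < a" "0 < b" "coprime a b"
  shows "card {r \<in> {0..<a * b}. a dvd poly G r \<and> b dvd poly H r} \<le>
    card (roots_mod G a) * card (roots_mod H b)"
proof -
  let ?S = "{r \<in> {0..<a * b}. a dvd poly G r \<and> b dvd poly H r}"
  have "inj_on (\<lambda>r. (r mod a, r mod b)) ?S"
  proof (rule inj_onI)
    fix r s assume rs: "r \<in> ?S" "s \<in> ?S" "(r mod a, r mod b) = (s mod a, s mod b)"
    then have "a dvd r - s" "b dvd r - s" by (simp_all add: mod_eq_dvd_iff)
    then have "r mod (a * b) = s mod (a * b)"
      using assms(3) by (simp add: mod_eq_dvd_iff divides_mult)
    then show "r = s" using rs(1,2) by simp
  qed
  moreover have "(\<lambda>r. (r mod a, r mod b)) ` ?S \<subseteq> roots_mod G a \<times> roots_mod H b"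
    using assms by (auto simp: mod_in_roots_mod_iff)
  ultimately have "card ?S \<le> card (roots_mod G a \<times> roots_mod H b)"
    by (rule card_inj_on_le) simp
  then show ?thesis by (simp add: card_cartesian_product)
qed

lemma card_roots_mod_mult_le:
  assumes "0 < d" "squarefree d"
  shows "card (roots_mod (G * H) d) \<le>
    (\<Sum>a | 0 < a \<and> a dvd d. card (roots_mod G a) * card (roots_mod H (d div a)))"
proof -
  define S where "S a = {r \<in> {0..<d}. a dvd poly G r \<and> d div a dvd poly H r}" for a
  have fin: "finite {a. 0 < a \<and> a dvd d}"
    by (rule finite_subset[OF _ finite_divisors_int[of d]]) (use \<open>0 < d\<close> in auto)
  have finS: "finite (S a)" for a
    by (rule finite_subset[of _ "{0..<d}"]) (auto simp: S_def)
  have "roots_mod (G * H) d \<subseteq> (\<Union>a\<in>{a. 0 < a \<and> a dvd d}. S a)"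
  proof
    fix r assume r: "r \<in> roots_mod (G * H) d"
    then obtain a b where ab: "d = a * b" "a dvd poly G r" "b dvd poly H r"
      using division_decomp[of d "poly G r" "poly H r"] by (auto simp: roots_mod_def)
    then have d: "d = \<bar>a\<bar> * \<bar>b\<bar>" using \<open>0 < d\<close> by (metis abs_mult abs_of_pos)
    then have "d div \<bar>a\<bar> = \<bar>b\<bar>" using \<open>0 < d\<close> by auto
    then have "r \<in> S \<bar>a\<bar>" using ab r by (simp add: S_def roots_mod_def)
    moreover have "0 < \<bar>a\<bar>" "\<bar>a\<bar> dvd d" using ab(1) \<open>0 < d\<close> by auto
    ultimately show "r \<in> (\<Union>a\<in>{a. 0 < a \<and> a dvd d}. S a)" by blast
  qed
  then have "card (roots_mod (G * H) d) \<le> card (\<Union>a\<in>{a. 0 < a \<and> a dvd d}. S a)"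
    using fin finS by (intro card_mono finite_UN_I) auto
  also have "\<dots> \<le> (\<Sum>a | 0 < a \<and> a dvd d. card (S a))" by (rule card_UN_le[OF fin])
  also have "\<dots> \<le> (\<Sum>a | 0 < a \<and> a dvd d. card (roots_mod G a) * card (roots_mod H (d div a)))"
  proof (rule sum_mono)
    fix a assume a: "a \<in> {a. 0 < a \<and> a dvd d}"
    then have d: "d = a * (d div a)" by simp
    then have "coprime a (d div a)" using assms(2) by (metis coprime_if_squarefree_mult)
    moreover have "0 < d div a" using a \<open>0 < d\<close> by (simp add: pos_imp_zdiv_pos_iff zdvd_imp_le)
    ultimately show "card (S a) \<le> card (roots_mod G a) * card (roots_mod H (d div a))"
      using card_roots_mod_coprime_mult_le[of a "d div a" G H] a by (simp add: S_def)
  qed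
  finally show ?thesis .
qed

lemma sum_squarefree_convolution_le:
  fixes u v :: "int \<Rightarrow> real"
  assumes nonneg: "\<And>d. d \<in> squarefree_upto Q \<Longrightarrow> 0 \<le> u d" "\<And>d. d \<in> squarefree_upto Q \<Longrightarrow> 0 \<le> v d"
  shows "(\<Sum>d\<in>squarefree_upto Q. \<Sum>a | 0 < a \<and> a dvd d. u a * v (d div a)) \<le>
    sum u (squarefree_upto Q) * sum v (squarefree_upto Q)"
proof -
  let ?D = "squarefree_upto Q"
  have fin: "finite {a. 0 < a \<and> a dvd d}" if "d \<in> ?D" for d
    by (rule finite_subset[OF _ finite_divisors_int[of d]])
      (use that in \<open>auto simp: squarefree_upto_def\<close>)
  have "(\<Sum>d\<in>?D. \<Sum>a | 0 < a \<and> a dvd d. u a * v (d div a)) =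
      (\<Sum>(d, a)\<in>(SIGMA d:?D. {a. 0 < a \<and> a dvd d}). u a * v (d div a))"
    by (rule sum.Sigma) (use fin in auto)
  also have "\<dots> \<le> (\<Sum>(a, b)\<in>?D \<times> ?D. u a * v b)"
  proof (rule sum_le_included[where i = "\<lambda>(a, b). (a * b, a)"])
    show "finite (SIGMA d:?D. {a. 0 < a \<and> a dvd d})"
      by (intro finite_SigmaI finite_squarefree_upto fin)
    show "\<forall>y\<in>?D \<times> ?D. 0 \<le> (case y of (a, b) \<Rightarrow> u a * v b)"
      using nonneg by (auto intro: mult_nonneg_nonneg)
    show "\<forall>x\<in>(SIGMA d:?D. {a. 0 < a \<and> a dvd d}). \<exists>y\<in>?D \<times> ?D.
      (case y of (a, b) \<Rightarrow> (a * b, a)) = x \<and>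
      (case x of (d, a) \<Rightarrow> u a * v (d div a)) \<le> (case y of (a, b) \<Rightarrow> u a * v b)"
    proof clarify
      fix d a :: int assume d: "d \<in> ?D" and a: "0 < a" "a dvd d"
      have dvd: "b \<in> ?D" if "b dvd d" "0 < b" for b
        using d that zdvd_imp_le[of b d] squarefree_mono[of b d] by (simp add: squarefree_upto_def)
      have "d div a dvd d" using a(2) by (metis dvd_div_mult_self dvd_triv_left)
      moreover have "0 < d div a"
        using a d by (simp add: squarefree_upto_def pos_imp_zdiv_pos_iff zdvd_imp_le)
      ultimately show "\<exists>y\<in>?D \<times> ?D. (case y of (a, b) \<Rightarrow> (a * b, a)) = (d, a) \<and>
        u a * v (d div a) \<le> (case y of (a, b) \<Rightarrow> u a * v b)"
        using dvd a by (intro bexI[of _ "(a, d div a)"]) auto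
    qed
  qed simp
  also have "\<dots> = sum u ?D * sum v ?D"
    by (simp add: sum_product sum.cartesian_product)
  finally show ?thesis .
qed

lemma root_sum_mult_le: "root_sum (G * H) Q \<le> root_sum G Q * root_sum H Q"
proof -
  define w where "w P d = real (card (roots_mod P d)) / real_of_int d" for P d
  have "w (G * H) d \<le> (\<Sum>a | 0 < a \<and> a dvd d. w G a * w H (d div a))"
    if d: "d \<in> squarefree_upto Q" for d
  proof -
    have "real (card (roots_mod (G * H) d)) \<le>
        real (\<Sum>a | 0 < a \<and> a dvd d. card (roots_mod G a) * card (roots_mod H (d div a)))"
      using d card_roots_mod_mult_le[of d G H]
      by (simp only: of_nat_le_iff) (simp add: squarefree_upto_def)
    then have "w (G * H) d \<le>
        (\<Sum>a | 0 < a \<and> a dvd d. real (card (roots_mod G a)) * real (card (roots_mod H (d div a))))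
          / real_of_int d"
      unfolding w_def using d by (intro divide_right_mono) (auto simp: squarefree_upto_def)
    also have "\<dots> = (\<Sum>a | 0 < a \<and> a dvd d. w G a * w H (d div a))"
      unfolding sum_divide_distrib w_def by (intro sum.cong) (auto simp flip: of_int_mult)
    finally show ?thesis .
  qed
  then have "root_sum (G * H) Q \<le>
      (\<Sum>d\<in>squarefree_upto Q. \<Sum>a | 0 < a \<and> a dvd d. w G a * w H (d div a))"
    unfolding root_sum_def w_def[symmetric] by (rule sum_mono)
  also have "\<dots> \<le> sum (w G) (squarefree_upto Q) * sum (w H) (squarefree_upto Q)"
    by (rule sum_squarefree_convolution_le) (auto simp: w_def squarefree_upto_def)
  finally show ?thesis by (simp add: root_sum_def w_def)
qed

lemma root_sum_const_le:
  assumes "c \<noteq> 0"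
  shows "root_sum [:c:] Q \<le> real_of_int \<bar>c\<bar>"
proof -
  have roots: "roots_mod [:c:] d = (if d dvd c then {0..<d} else {})" for d
    by (auto simp: roots_mod_def)
  have "root_sum [:c:] Q = (\<Sum>d\<in>squarefree_upto Q. of_bool (d dvd c))"
    unfolding root_sum_def by (intro sum.cong) (auto simp: roots squarefree_upto_def)
  also have "\<dots> = real (card (squarefree_upto Q \<inter> {d. d dvd c}))"
    by (rule sum_of_bool_eq; simp)
  also have "card (squarefree_upto Q \<inter> {d. d dvd c}) \<le> card {1..\<bar>c\<bar>}"
    using assms zdvd_imp_le[of _ "\<bar>c\<bar>"] by (intro card_mono) (auto simp: squarefree_upto_def)
  finally show ?thesis by simp
qed

lemma root_sum_prod_le:
  assumes "finite A"
  shows "root_sum (\<Prod>g\<in>A. f g) Q \<le> (\<Prod>g\<in>A. root_sum (f g) Q)"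
  using assms
proof (induction A rule: finite_induct)
  case empty
  show ?case using root_sum_const_le[of 1 Q] by (simp add: pCons_one)
next
  case (insert x A)
  have "root_sum (f x * (\<Prod>g\<in>A. f g)) Q \<le> root_sum (f x) Q * root_sum (\<Prod>g\<in>A. f g) Q"
    by (rule root_sum_mult_le)
  also have "\<dots> \<le> root_sum (f x) Q * (\<Prod>g\<in>A. root_sum (f g) Q)"
    using insert.IH by (intro mult_left_mono root_sum_nonneg)
  finally show ?case using insert.hyps by simp
qed

lemma root_sum_le_prod_prime_factors:
  assumes "P \<noteq> 0"
  shows "root_sum P Q \<le> root_sum (\<Prod>g\<in>prime_factors P. g) Q"
  unfolding root_sum_def
proof (intro sum_mono divide_right_mono of_nat_mono card_mono finite_roots_mod subsetI)
  fix d r assume d: "d \<in> squarefree_upto Q" and r: "r \<in> roots_mod P d"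
  have "d dvd poly (\<Prod>g\<in>prime_factors P. g) r"
  proof (rule squarefree_dvdI)
    fix p assume p: "prime p" "p dvd d"
    have "P dvd prod_mset (prime_factorization P)"
      using prod_mset_prime_factorization_weak[OF assms]
      by (metis dvd_normalize_iff dvd_refl normalize_dvd_iff)
    then have "poly P r dvd poly (prod_mset (prime_factorization P)) r"
      by (metis dvdE dvdI poly_mult)
    then have "poly P r dvd (\<Prod>g\<in>#prime_factorization P. poly g r)"
      using poly_prod_mset[of "\<lambda>g. g" "prime_factorization P" r] by simp
    then have "p dvd (\<Prod>g\<in>#prime_factorization P. poly g r)"
      using p(2) r by (auto simp: roots_mod_def intro: dvd_trans)
    then have "\<exists>y\<in>#image_mset (\<lambda>g. poly g r) (prime_factorization P). p dvd y"
      using prime_dvd_prod_mset_iff[OF \<open>prime p\<close>] by blast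
    then obtain g where "g \<in> prime_factors P" "p dvd poly g r" by auto
    then show "p dvd poly (\<Prod>g\<in>prime_factors P. g) r"
      unfolding poly_prod by (meson dvd_prodI dvd_trans finite_set_mset)
  qed (use d in \<open>simp add: squarefree_upto_def\<close>)
  then show "r \<in> roots_mod (\<Prod>g\<in>prime_factors P. g) d" using r by (simp add: roots_mod_def)
qed (auto simp: squarefree_upto_def)

lemma root_sum_le_ln_power:
  assumes "P \<noteq> 0"
  shows "\<exists>C\<ge>0. \<forall>Q\<ge>2. root_sum P Q \<le> C * ln (real_of_int Q) ^ num_irreducible_factors P"
proof -
  define A where "A = prime_factors P"
  have irr: "irreducible g" if "g \<in> A" for g
    using that by (simp add: A_def in_prime_factors_iff prime_def prime_elem_iff_irreducible)
  have "\<exists>C\<ge>0. \<forall>Q\<ge>2. root_sum g Q \<le> C * (if 0 < degree g then ln (real_of_int Q) else 1)"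
    if "g \<in> A" for g
  proof (cases "0 < degree g")
    case True
    with root_sum_irreducible_le[OF irr[OF that]] show ?thesis by simp
  next
    case False
    then obtain c where "g = [:c:]" by (auto elim: degree_eq_zeroE)
    with root_sum_const_le[of c] irr[OF that] show ?thesis
      by (intro exI[of _ "real_of_int \<bar>c\<bar>"]) auto
  qed
  then have "\<forall>g\<in>A. \<exists>C. 0 \<le> C \<and>
      (\<forall>Q\<ge>2. root_sum g Q \<le> C * (if 0 < degree g then ln (real_of_int Q) else 1))"
    by blast
  from bchoice[OF this] obtain C where C: "\<And>g. g \<in> A \<Longrightarrow> 0 \<le> C g"
    "\<And>g Q. g \<in> A \<Longrightarrow> 2 \<le> Q \<Longrightarrow> root_sum g Q \<le> C g * (if 0 < degree g then ln (real_of_int Q) else 1)"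
    by blast
  have factors: "{g. irreducible g \<and> 0 < degree g \<and> normalize g = g \<and> g dvd P} = {g\<in>A. 0 < degree g}"
    using assms by (auto simp: A_def in_prime_factors_iff prime_def prime_elem_iff_irreducible)
  have "root_sum P Q \<le> (\<Prod>g\<in>A. C g) * ln (real_of_int Q) ^ num_irreducible_factors P"
    if "2 \<le> Q" for Q
  proof -
    have "root_sum P Q \<le> (\<Prod>g\<in>A. root_sum g Q)"
      using root_sum_le_prod_prime_factors[OF assms, of Q] root_sum_prod_le[of A "\<lambda>g. g" Q]
      by (simp add: A_def)
    also have "\<dots> \<le> (\<Prod>g\<in>A. C g * (if 0 < degree g then ln (real_of_int Q) else 1))"
      using C(2)[OF _ that] by (intro prod_mono conjI root_sum_nonneg)
    also have "\<dots> = (\<Prod>g\<in>A. C g) * ln (real_of_int Q) ^ num_irreducible_factors P"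
      unfolding num_irreducible_factors_def factors prod.distrib
      by (subst prod.inter_filter[symmetric]) (simp_all add: A_def)
    finally show ?thesis .
  qed
  moreover have "0 \<le> (\<Prod>g\<in>A. C g)" using C(1) by (simp add: prod_nonneg)
  ultimately show ?thesis by (intro exI[of _ "\<Prod>g\<in>A. C g"]) simp
qed

section \<open>Equidistribution of the numerators\<close>

lemma card_roots_block:
  assumes "0 < e"
  shows "card {a \<in> {b + 1..b + e}. e dvd poly P a} = card (roots_mod P e)"
proof -
  let ?S = "{a \<in> {b + 1..b + e}. e dvd poly P a}"
  have inj: "inj_on (\<lambda>a. a mod e) ?S"
  proof (rule inj_onI)
    fix x y assume xy: "x \<in> ?S" "y \<in> ?S" "x mod e = y mod e"
    then have "(x - (b + 1)) mod e = (y - (b + 1)) mod e" by (intro mod_diff_cong) simp_all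
    then show "x = y" using xy(1,2) by simp
  qed
  have "(\<lambda>a. a mod e) ` ?S = roots_mod P e"
  proof
    show "(\<lambda>a. a mod e) ` ?S \<subseteq> roots_mod P e"
      using \<open>0 < e\<close> by (intro image_subsetI) (simp add: mod_in_roots_mod_iff)
    show "roots_mod P e \<subseteq> (\<lambda>a. a mod e) ` ?S"
    proof
      fix r assume r: "r \<in> roots_mod P e"
      define a where "a = b + 1 + (r - (b + 1)) mod e"
      have "a mod e = r" using r by (simp add: a_def mod_add_right_eq roots_mod_def)
      moreover have "a \<in> {b + 1..b + e}"
        using pos_mod_bound[OF \<open>0 < e\<close>, of "r - (b + 1)"] pos_mod_sign[OF \<open>0 < e\<close>, of "r - (b + 1)"]
        unfolding a_def atLeastAtMost_iff by linarith
      moreover have "e dvd poly P a"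
        using r mod_in_roots_mod_iff[OF \<open>0 < e\<close>, of a P] \<open>a mod e = r\<close> by simp
      ultimately show "r \<in> (\<lambda>a. a mod e) ` ?S" by (intro image_eqI[of r _ a]) simp_all
    qed
  qed
  then show ?thesis by (simp only: card_image[OF inj, symmetric])
qed

lemma card_roots_upto_multiple:
  assumes "0 < e"
  shows "card {a \<in> {1..int k * e}. e dvd poly P a} = k * card (roots_mod P e)"
proof (induction k)
  case (Suc k)
  let ?R = "\<lambda>A. {a \<in> A. e dvd poly P a}"
  have fin: "finite (?R {x..y})" for x y by (rule finite_subset[of _ "{x..y}"]) auto
  define b where "b = int k * e"
  have "0 \<le> b" "int (Suc k) * e = b + e" using \<open>0 < e\<close> by (simp_all add: b_def algebra_simps)
  then have "?R {1..int (Suc k) * e} = ?R {1..b} \<union> ?R {b + 1..b + e}" using \<open>0 < e\<close> by auto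
  then have "card (?R {1..int (Suc k) * e}) = card (?R {1..b} \<union> ?R {b + 1..b + e})" by (simp only:)
  also have "\<dots> = card (?R {1..b}) + card (?R {b + 1..b + e})"
    by (rule card_Un_disjoint[OF fin fin]) auto
  also have "\<dots> = k * card (roots_mod P e) + card (roots_mod P e)"
    using Suc.IH card_roots_block[OF \<open>0 < e\<close>] by (simp only: b_def)
  finally show ?case by simp
qed simp

lemma card_roots_upto_approx:
  fixes x :: real
  assumes "0 < e" "0 \<le> x"
  shows "\<bar>real (card {a \<in> {1..\<lfloor>x\<rfloor>}. e dvd poly P a}) - x / real_of_int e * real (card (roots_mod P e))\<bar>
    \<le> real (card (roots_mod P e))"
proof -
  let ?N = "\<lambda>m. card {a \<in> {1..m}. e dvd poly P a}" and ?\<rho> = "card (roots_mod P e)"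
  have mono: "?N m \<le> ?N n" if "m \<le> n" for m n :: int
    using that by (intro card_mono finite_Collect_conjI disjI1) auto
  define k where "k = nat \<lfloor>x / real_of_int e\<rfloor>"
  have k: "real k \<le> x / real_of_int e" "x / real_of_int e \<le> real k + 1"
    using assms by (auto simp: k_def)
  have x: "real_of_int (int k * e) \<le> x" "x \<le> real_of_int (int (Suc k) * e)"
    using k \<open>0 < e\<close> by (simp_all add: field_simps)
  have lower: "int k * e \<le> \<lfloor>x\<rfloor>" using x(1) by (simp only: le_floor_iff)
  have upper: "\<lfloor>x\<rfloor> \<le> int (Suc k) * e" using floor_mono[OF x(2)] by (simp only: floor_of_int)
  from mono[OF lower] mono[OF upper] have "k * ?\<rho> \<le> ?N \<lfloor>x\<rfloor>" "?N \<lfloor>x\<rfloor> \<le> Suc k * ?\<rho>"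
    by (simp_all only: card_roots_upto_multiple[OF \<open>0 < e\<close>])
  then have "real (k * ?\<rho>) \<le> real (?N \<lfloor>x\<rfloor>)" "real (?N \<lfloor>x\<rfloor>) \<le> real (Suc k * ?\<rho>)"
    by (simp_all only: of_nat_le_iff)
  moreover have "real k * ?\<rho> \<le> x / real_of_int e * ?\<rho>" "x / real_of_int e * ?\<rho> \<le> (real k + 1) * ?\<rho>"
    using k by (simp_all only: mult_right_mono of_nat_0_le_iff)
  ultimately show ?thesis by (simp add: abs_le_iff algebra_simps)
qed

lemma card_roots_upto_eq:
  assumes "0 < e" "e dvd q" "0 \<le> q"
  shows "real (card {a \<in> {1..q}. e dvd poly P a}) =
    real_of_int q / real_of_int e * real (card (roots_mod P e))"
proof -
  obtain k where "q = int k * e"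
    using assms by (metis dvd_div_mult_self nonneg_int_cases pos_imp_zdiv_nonneg_iff)
  then show ?thesis
    using \<open>0 < e\<close> by (simp only: card_roots_upto_multiple[OF \<open>0 < e\<close>]) simp
qed

lemma coprime_iff_no_prime_factor_dvd:
  fixes x q :: "'a :: factorial_semiring_gcd"
  assumes "q \<noteq> 0"
  shows "coprime x q \<longleftrightarrow> (\<forall>p\<in>prime_factors q. \<not> p dvd x)"
proof
  assume "coprime x q"
  then show "\<forall>p\<in>prime_factors q. \<not> p dvd x"
    by (metis coprime_common_divisor in_prime_factors_imp_dvd in_prime_factors_imp_prime
        not_prime_unit)
next
  assume *: "\<forall>p\<in>prime_factors q. \<not> p dvd x"
  show "coprime x q"
  proof (rule ccontr)
    assume "\<not> coprime x q"
    then have "\<not> is_unit (gcd x q)" by (simp add: coprime_iff_gcd_eq_1)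
    then obtain p where "prime p" "p dvd gcd x q"
      using prime_divisor_exists[of "gcd x q"] \<open>q \<noteq> 0\<close> by auto
    then show False using * \<open>q \<noteq> 0\<close> by (auto simp: in_prime_factors_iff)
  qed
qed

lemma squarefree_prod_primes:
  fixes D :: "'a :: factorial_semiring_gcd set"
  assumes "\<And>p. p \<in> D \<Longrightarrow> prime p"
  shows "squarefree (\<Prod>D)"
  using assms by (intro squarefree_prod_coprime) (auto intro: primes_coprime squarefree_prime)

lemma prime_dvd_prod_primes_iff:
  fixes D :: "'a :: factorial_semiring_gcd set"
  assumes "finite D" "\<And>p. p \<in> D \<Longrightarrow> prime p" "prime p"
  shows "p dvd \<Prod>D \<longleftrightarrow> p \<in> D"
  using assms by (metis dvd_refl prime_dvd_prod_iff primes_dvd_imp_eq)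

lemma prod_primes_dvd_iff:
  fixes D :: "'a :: factorial_semiring_gcd set"
  assumes "finite D" "\<And>p. p \<in> D \<Longrightarrow> prime p"
  shows "\<Prod>D dvd x \<longleftrightarrow> (\<forall>p\<in>D. p dvd x)"
proof
  assume "\<Prod>D dvd x"
  moreover have "p dvd \<Prod>D" if "p \<in> D" for p
    using prime_dvd_prod_primes_iff[OF assms] assms(2) that by simp
  ultimately show "\<forall>p\<in>D. p dvd x" using dvd_trans by blast
next
  assume dvd: "\<forall>p\<in>D. p dvd x"
  show "\<Prod>D dvd x"
  proof (rule squarefree_dvdI)
    show "squarefree (\<Prod>D)" by (rule squarefree_prod_primes[OF assms(2)])
    show "p dvd x" if "prime p" "p dvd \<Prod>D" for p
      using prime_dvd_prod_primes_iff[OF assms \<open>prime p\<close>] that dvd by simp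
  qed
qed

lemma of_bool_coprime_eq_sum:
  fixes x q :: "'a :: factorial_semiring_gcd"
  assumes "q \<noteq> 0"
  shows "(of_bool (coprime x q) :: 'b :: comm_ring_1) =
    (\<Sum>D\<in>Pow (prime_factors q). (- 1) ^ card D * of_bool (\<Prod>D dvd x))"
proof -
  have of_bool_prod: "(\<Prod>p\<in>D. of_bool (R p) :: 'b) = of_bool (\<forall>p\<in>D. R p)"
    if "finite D" for D and R :: "'a \<Rightarrow> bool"
    using that by (induction D rule: finite_induct) auto
  have "of_bool (coprime x q) = (\<Prod>p\<in>prime_factors q. 1 - of_bool (p dvd x) :: 'b)"
    unfolding coprime_iff_no_prime_factor_dvd[OF assms] of_bool_not_iff[symmetric] 
    by (rule of_bool_prod[symmetric]) simp
  also have "\<dots> = (\<Sum>D\<in>Pow (prime_factors q). (- 1) ^ card D * (\<Prod>p\<in>D. of_bool (p dvd x)))"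
    by (simp add: prod_diff_conv_sum)
  also have "\<dots> = (\<Sum>D\<in>Pow (prime_factors q). (- 1) ^ card D * of_bool (\<Prod>D dvd x))"
  proof (intro sum.cong refl arg_cong[of _ _ "(*) _"])
    fix D assume "D \<in> Pow (prime_factors q)"
    then have D: "finite D" "\<And>p. p \<in> D \<Longrightarrow> prime p" using finite_subset by auto
    show "(\<Prod>p\<in>D. of_bool (p dvd x)) = (of_bool (\<Prod>D dvd x) :: 'b)"
      by (simp add: of_bool_prod[OF D(1)] prod_primes_dvd_iff[OF D])
  qed
  finally show ?thesis .
qed

lemma sum_prod_prime_factors_le:
  fixes f :: "int \<Rightarrow> real"
  assumes "0 < q" and nonneg: "\<And>d. 0 \<le> f d"
  shows "(\<Sum>D\<in>Pow (prime_factors q). f (\<Prod>D)) \<le> (\<Sum>d | d \<in> squarefree_upto q \<and> d dvd q. f d)"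
proof -
  have D: "finite D" "\<And>p. p \<in> D \<Longrightarrow> prime p" if "D \<in> Pow (prime_factors q)" for D
    using that finite_subset by auto
  have "inj_on (\<lambda>D. \<Prod>D) (Pow (prime_factors q))"
  proof (rule inj_onI)
    fix D E assume DE: "D \<in> Pow (prime_factors q)" "E \<in> Pow (prime_factors q)" "\<Prod>D = \<Prod>E"
    have "p \<in> D \<longleftrightarrow> p \<in> E" if "prime p" for p
      using prime_dvd_prod_primes_iff[OF D[OF DE(1)] that]
        prime_dvd_prod_primes_iff[OF D[OF DE(2)] that] DE(3)
      by simp
    then show "D = E" using D(2) DE(1,2) by blast
  qed
  then have "(\<Sum>D\<in>Pow (prime_factors q). f (\<Prod>D)) = (\<Sum>d\<in>(\<lambda>D. \<Prod>D) ` Pow (prime_factors q). f d)"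
    by (simp add: sum.reindex)
  also have "\<dots> \<le> (\<Sum>d | d \<in> squarefree_upto q \<and> d dvd q. f d)"
  proof (rule sum_mono2)
    show "(\<lambda>D. \<Prod>D) ` Pow (prime_factors q) \<subseteq> {d. d \<in> squarefree_upto q \<and> d dvd q}"
    proof (rule image_subsetI)
      fix D assume "D \<in> Pow (prime_factors q)"
      note D = this D[OF this]
      have "0 < \<Prod>D" using D(3) by (intro prod_pos) (auto dest: prime_gt_0_int)
      moreover have "\<Prod>D dvd q" using D by (auto simp: prod_primes_dvd_iff)
      moreover have "squarefree (\<Prod>D)" by (rule squarefree_prod_primes[OF D(3)])
      ultimately show "\<Prod>D \<in> {d. d \<in> squarefree_upto q \<and> d dvd q}"
        using \<open>0 < q\<close> by (simp add: squarefree_upto_def zdvd_imp_le)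
    qed
  qed (use nonneg in auto)
  finally show ?thesis .
qed

definition reduced_numerators :: "int poly \<Rightarrow> int \<Rightarrow> real \<Rightarrow> int set" where
  "reduced_numerators P q x = {a \<in> {1..\<lfloor>x\<rfloor>}. coprime (poly P a) q}"

lemma finite_reduced_numerators [simp]: "finite (reduced_numerators P q x)"
  by (rule finite_subset[of _ "{1..\<lfloor>x\<rfloor>}"]) (auto simp: reduced_numerators_def)

lemma card_reduced_numerators_eq_sum:
  assumes "q \<noteq> 0"
  shows "real (card (reduced_numerators P q x)) =
    (\<Sum>D\<in>Pow (prime_factors q). (- 1) ^ card D * real (card {a \<in> {1..\<lfloor>x\<rfloor>}. \<Prod>D dvd poly P a}))"
proof -
  have card_eq: "real (card {a \<in> A. R a}) = (\<Sum>a\<in>A. of_bool (R a))"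
    if "finite A" for A and R :: "int \<Rightarrow> bool"
    using that by (simp add: Int_def)
  have "real (card (reduced_numerators P q x)) = (\<Sum>a\<in>{1..\<lfloor>x\<rfloor>}. of_bool (coprime (poly P a) q))"
    unfolding reduced_numerators_def by (rule card_eq) simp
  also have "\<dots> = (\<Sum>D\<in>Pow (prime_factors q). \<Sum>a\<in>{1..\<lfloor>x\<rfloor>}. (- 1) ^ card D * of_bool (\<Prod>D dvd poly P a))"
    unfolding of_bool_coprime_eq_sum[OF assms] by (rule sum.swap)
  finally show ?thesis by (simp only: card_eq[OF finite_atLeastAtMost_int] sum_distrib_left)
qed

lemma reduced_numerators_equidistributed:
  fixes \<alpha> :: real
  assumes "0 < q" "0 \<le> \<alpha>"
  shows "\<bar>real (card (reduced_numerators P q (\<alpha> * q))) - \<alpha> * real (card (reduced_numerators P q q))\<bar>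
    \<le> (\<Sum>d | d \<in> squarefree_upto q \<and> d dvd q. real (card (roots_mod P d)))"
proof -
  let ?N = "\<lambda>D x. real (card {a \<in> {1..\<lfloor>x\<rfloor>}. \<Prod>D dvd poly P a})"
  have eq: "real (card (reduced_numerators P q (\<alpha> * q))) - \<alpha> * real (card (reduced_numerators P q q)) =
      (\<Sum>D\<in>Pow (prime_factors q). (- 1) ^ card D * (?N D (\<alpha> * q) - \<alpha> * ?N D q))"
    using \<open>0 < q\<close>
    by (simp add: card_reduced_numerators_eq_sum right_diff_distrib sum_subtractf sum_distrib_left
        mult_ac)
  have "\<bar>real (card (reduced_numerators P q (\<alpha> * q))) - \<alpha> * real (card (reduced_numerators P q q))\<bar>
      \<le> (\<Sum>D\<in>Pow (prime_factors q). \<bar>?N D (\<alpha> * q) - \<alpha> * ?N D q\<bar>)"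
    unfolding eq by (rule order_trans[OF sum_abs]) (simp add: abs_mult)
  also have "\<dots> \<le> (\<Sum>D\<in>Pow (prime_factors q). real (card (roots_mod P (\<Prod>D))))"
  proof (rule sum_mono)
    fix D assume "D \<in> Pow (prime_factors q)"
    then have D: "finite D" "\<And>p. p \<in> D \<Longrightarrow> prime p" "\<And>p. p \<in> D \<Longrightarrow> p dvd q" using finite_subset by auto
    then have "0 < \<Prod>D" "\<Prod>D dvd q"
      by (auto simp: prod_primes_dvd_iff prime_gt_0_int intro: prod_pos)
    then show "\<bar>?N D (\<alpha> * q) - \<alpha> * ?N D q\<bar> \<le> real (card (roots_mod P (\<Prod>D)))"
      using card_roots_upto_approx[of "\<Prod>D" "\<alpha> * q" P] card_roots_upto_eq[of "\<Prod>D" q P] assms by simp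
  qed
  also have "\<dots> \<le> (\<Sum>d | d \<in> squarefree_upto q \<and> d dvd q. real (card (roots_mod P d)))"
    using \<open>0 < q\<close> by (intro sum_prod_prime_factors_le) auto
  finally show ?thesis .
qed

lemma card_multiples_le:
  fixes d Q :: int
  assumes "0 < d" "0 \<le> Q"
  shows "real (card {q \<in> {1..Q}. d dvd q}) \<le> real_of_int Q / real_of_int d"
proof -
  have "{q \<in> {1..Q}. d dvd q} \<subseteq> (\<lambda>k. d * k) ` {1..Q div d}"
  proof
    fix q assume q: "q \<in> {q \<in> {1..Q}. d dvd q}"
    then have "q = d * (q div d)" "1 \<le> q div d" "q div d \<le> Q div d"
      using \<open>0 < d\<close>
      by (auto simp: zdiv_mono1 pos_imp_zdiv_pos_iff zdvd_imp_le int_one_le_iff_zero_less)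
    then show "q \<in> (\<lambda>k. d * k) ` {1..Q div d}" by auto
  qed
  then have "card {q \<in> {1..Q}. d dvd q} \<le> card {1..Q div d}"
    by (rule surj_card_le[OF finite_atLeastAtMost_int])
  moreover have "0 \<le> Q div d" using assms by (simp add: pos_imp_zdiv_nonneg_iff)
  ultimately have "real (card {q \<in> {1..Q}. d dvd q}) \<le> real_of_int (Q div d)" by simp
  also have "\<dots> \<le> real_of_int Q / real_of_int d" by (rule real_of_int_div4)
  finally show ?thesis .
qed

definition reduced_pairs :: "int poly \<Rightarrow> int \<Rightarrow> real \<Rightarrow> (int \<times> int) set" where
  "reduced_pairs P Q \<alpha> = (SIGMA q:{1..Q}. reduced_numerators P q (\<alpha> * real_of_int q))"

lemma card_reduced_pairs:
  "card (reduced_pairs P Q \<alpha>) = (\<Sum>q=1..Q. card (reduced_numerators P q (\<alpha> * real_of_int q)))"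
  by (simp add: reduced_pairs_def card_SigmaI)

lemma reduced_pairs_equidistributed:
  fixes \<alpha> :: real
  assumes "0 \<le> Q" "0 \<le> \<alpha>"
  shows "\<bar>real (card (reduced_pairs P Q \<alpha>)) - \<alpha> * real (card (reduced_pairs P Q 1))\<bar>
    \<le> real_of_int Q * root_sum P Q"
proof -
  have "\<bar>real (card (reduced_pairs P Q \<alpha>)) - \<alpha> * real (card (reduced_pairs P Q 1))\<bar> \<le>
      (\<Sum>q=1..Q. \<bar>real (card (reduced_numerators P q (\<alpha> * q)))
        - \<alpha> * real (card (reduced_numerators P q q))\<bar>)"
    unfolding card_reduced_pairs of_nat_sum sum_distrib_left sum_subtractf[symmetric] mult_1
    by (rule sum_abs)
  also have "\<dots> \<le> (\<Sum>q=1..Q. \<Sum>d | d \<in> squarefree_upto q \<and> d dvd q. real (card (roots_mod P d)))"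
    using \<open>0 \<le> \<alpha>\<close> by (intro sum_mono reduced_numerators_equidistributed) auto
  also have "\<dots> = (\<Sum>q=1..Q. \<Sum>d | d \<in> squarefree_upto Q \<and> d dvd q. real (card (roots_mod P d)))"
  proof (intro sum.cong refl Collect_cong)
    fix q d assume "q \<in> {1..Q}"
    then show "d \<in> squarefree_upto q \<and> d dvd q \<longleftrightarrow> d \<in> squarefree_upto Q \<and> d dvd q"
      using zdvd_imp_le[of d q] by (auto simp: squarefree_upto_def)
  qed
  also have "\<dots> = (\<Sum>d\<in>squarefree_upto Q. \<Sum>q | q \<in> {1..Q} \<and> d dvd q. real (card (roots_mod P d)))"
    by (rule sum.swap_restrict) simp_all
  also have "\<dots> = (\<Sum>d\<in>squarefree_upto Q. real (card {q \<in> {1..Q}. d dvd q}) * real (card (roots_mod P d)))"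
    by simp
  also have "\<dots> \<le> (\<Sum>d\<in>squarefree_upto Q. (real_of_int Q / real_of_int d) * real (card (roots_mod P d)))"
    using \<open>0 \<le> Q\<close>
    by (intro sum_mono mult_right_mono card_multiples_le) (auto simp: squarefree_upto_def)
  also have "\<dots> = real_of_int Q * root_sum P Q"
    by (simp add: root_sum_def sum_distrib_left)
  finally show ?thesis .
qed

section \<open>A quadratic lower bound for the number of fractions\<close>

lemma card_roots_mod_prime_le:
  assumes "prime p" "\<not> p dvd lead_coeff P"
  shows "card (roots_mod P p) \<le> degree P"
  using assms(2)
proof (induction "degree P" arbitrary: P)
  case 0
  then obtain c where "P = [:c:]" by (metis degree_eq_zeroE)
  then have "roots_mod P p = {}" using 0 by (auto simp: roots_mod_def)
  then show ?case by simp
next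
  case (Suc m)
  show ?case
  proof (cases "roots_mod P p = {}")
    case False
    then obtain r where r: "r \<in> roots_mod P p" by blast
    define S where "S = synthetic_div P r"
    have P: "P = [:- r, 1:] * S + [:poly P r:]"
      unfolding S_def by (rule synthetic_div_correct'[symmetric])
    have degS: "degree S = m" using Suc.hyps(2) by (simp add: S_def degree_synthetic_div)
    have "coeff P (Suc m) = coeff S m"
      using arg_cong[OF P, of "\<lambda>q. coeff q (Suc m)"] degS by (simp add: coeff_eq_0)
    then have "\<not> p dvd lead_coeff S" using Suc.hyps(2) Suc.prems degS by simp
    then have IH: "card (roots_mod S p) \<le> m" using Suc.hyps(1)[of S] degS by simp
    have "roots_mod P p \<subseteq> insert r (roots_mod S p)"
    proof
      fix s assume s: "s \<in> roots_mod P p"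
      have "poly P s - poly P r = (s - r) * poly S s" by (subst (1) P) (simp add: algebra_simps)
      moreover have "p dvd poly P s - poly P r" using r s by (simp add: roots_mod_def)
      ultimately have "p dvd s - r \<or> p dvd poly S s"
        using \<open>prime p\<close> by (simp add: prime_dvd_mult_iff)
      then show "s \<in> insert r (roots_mod S p)"
        using roots_mod_eqI[OF s r] s by (auto simp: roots_mod_def)
    qed
    then have "card (roots_mod P p) \<le> card (insert r (roots_mod S p))" by (intro card_mono) auto
    also have "\<dots> \<le> Suc (card (roots_mod S p))" by (simp add: card_insert_if)
    finally show ?thesis using IH Suc.hyps(2) by simp
  qed simp
qed

lemma card_reduced_numerators_ge:
  assumes q: "0 < q" and lc: "\<And>p. p \<in> prime_factors q \<Longrightarrow> \<not> p dvd lead_coeff P"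
  shows "real_of_int q - real (degree P) * real_of_int q * (\<Sum>p\<in>prime_factors q. 1 / real_of_int p)
    \<le> real (card (reduced_numerators P q q))"
proof -
  define B where "B p = {a \<in> {1..q}. p dvd poly P a}" for p
  have B: "real (card (B p)) \<le> real (degree P) * real_of_int q * (1 / real_of_int p)"
    if p: "p \<in> prime_factors q" for p
  proof -
    have "prime p" "p dvd q" using p by auto
    moreover from \<open>prime p\<close> have "0 < p" by (rule prime_gt_0_int)
    ultimately have "real (card (B p)) = real_of_int q / real_of_int p * real (card (roots_mod P p))"
      using q by (simp only: B_def card_roots_upto_eq less_imp_le)
    also have "\<dots> \<le> real_of_int q / real_of_int p * real (degree P)"
      using q \<open>0 < p\<close> card_roots_mod_prime_le[OF \<open>prime p\<close> lc[OF p]] by (intro mult_left_mono) auto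
    finally show ?thesis by (simp add: mult_ac)
  qed
  have finB: "finite (B p)" for p
    by (rule finite_subset[of _ "{1..q}"]) (auto simp: B_def)
  have "{1..q} \<subseteq> reduced_numerators P q q \<union> (\<Union>p\<in>prime_factors q. B p)"
    using q coprime_iff_no_prime_factor_dvd[of q] by (auto simp: reduced_numerators_def B_def)
  then have "card {1..q} \<le> card (reduced_numerators P q q \<union> (\<Union>p\<in>prime_factors q. B p))"
    using finB by (intro card_mono) auto
  also have "\<dots> \<le> card (reduced_numerators P q q) + card (\<Union>p\<in>prime_factors q. B p)"
    by (rule card_Un_le)
  also have "card (\<Union>p\<in>prime_factors q. B p) \<le> (\<Sum>p\<in>prime_factors q. card (B p))"
    by (rule card_UN_le) simp
  finally have "real (card {1..q}) \<le>
      real (card (reduced_numerators P q q) + (\<Sum>p\<in>prime_factors q. card (B p)))"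
    by (simp only: of_nat_le_iff)
  then have "real_of_int q \<le>
      real (card (reduced_numerators P q q)) + (\<Sum>p\<in>prime_factors q. real (card (B p)))"
    using q by simp
  also have "(\<Sum>p\<in>prime_factors q. real (card (B p))) \<le>
      (\<Sum>p\<in>prime_factors q. real (degree P) * real_of_int q * (1 / real_of_int p))"
    by (intro sum_mono B)
  finally show ?thesis by (simp add: sum_distrib_left)
qed

lemma sum_inverse_squares_le:
  fixes K Q :: int
  assumes "0 < K"
  shows "(\<Sum>m\<in>{K<..Q}. 1 / (real_of_int m)\<^sup>2) \<le> 1 / real_of_int K"
proof (cases "K \<le> Q")
  case True
  then have "(\<Sum>m\<in>{K<..Q}. 1 / (real_of_int m)\<^sup>2) \<le> 1 / real_of_int K - 1 / real_of_int Q"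
  proof (induction Q rule: int_ge_induct)
    case (step Q)
    define x where "x = real_of_int Q"
    have "0 < x" using assms step.hyps by (simp add: x_def)
    have "{K<..Q + 1} = insert (Q + 1) {K<..Q}" using step.hyps by auto
    then have "(\<Sum>m\<in>{K<..Q + 1}. 1 / (real_of_int m)\<^sup>2) \<le> 1 / (x + 1)\<^sup>2 + (1 / real_of_int K - 1 / x)"
      using step.IH by (simp add: x_def)
    also have "1 / (x + 1)\<^sup>2 \<le> 1 / (x * (x + 1))"
      using \<open>0 < x\<close> by (intro divide_left_mono) (auto simp: power2_eq_square)
    also have "\<dots> = 1 / x - 1 / (x + 1)" using \<open>0 < x\<close> by (simp add: field_simps)
    finally show ?case by (simp add: x_def)
  qed simp
  also have "\<dots> \<le> 1 / real_of_int K" using True assms by simp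
  finally show ?thesis .
qed (use assms in simp)

lemma sum_inverse_le_ln:
  fixes Q :: int
  assumes "1 \<le> Q"
  shows "(\<Sum>m=1..Q. 1 / real_of_int m) \<le> 1 + ln (real_of_int Q)"
  using assms
proof (induction Q rule: int_ge_induct)
  case (step Q)
  define x where "x = real_of_int Q"
  have "1 \<le> x" using step.hyps by (simp add: x_def)
  have "ln (x / (x + 1)) \<le> x / (x + 1) - 1" using \<open>1 \<le> x\<close> by (intro ln_le_minus_one) auto
  also have "\<dots> = - (1 / (x + 1))" using \<open>1 \<le> x\<close> by (simp add: field_simps)
  finally have "1 / (x + 1) \<le> ln (x + 1) - ln x" using \<open>1 \<le> x\<close> by (simp add: ln_div)
  moreover have "{1..Q + 1} = insert (Q + 1) {1..Q}" using step.hyps by auto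
  ultimately show ?case using step.IH by (simp add: x_def add.commute)
qed simp

lemma not_dvd_if_dvd_one_plus_mult:
  fixes p M k :: int
  assumes "prime p" "p dvd 1 + M * k"
  shows "\<not> p dvd M"
proof
  assume "p dvd M"
  then have "p dvd (1 + M * k) - M * k" using assms(2) by (intro dvd_diff) auto
  then have "is_unit p" by simp
  with \<open>prime p\<close> show False using not_prime_unit by blast
qed

lemma card_prime_dvd_progression_le:
  fixes p M X :: int
  assumes "prime p" "\<not> p dvd M" "0 \<le> X"
  shows "real (card {k \<in> {1..X}. p dvd 1 + M * k}) \<le> real_of_int X / real_of_int p + 1"
proof -
  have "0 < p" using \<open>prime p\<close> by (rule prime_gt_0_int)
  have "M \<noteq> 0" using assms by auto
  let ?\<rho> = "real (card (roots_mod [:1, M:] p))"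
  have "?\<rho> \<le> 1" using card_roots_mod_prime_le[of p "[:1, M:]"] assms \<open>M \<noteq> 0\<close> by simp
  have "real (card {k \<in> {1..\<lfloor>real_of_int X\<rfloor>}. p dvd poly [:1, M:] k}) \<le>
      real_of_int X / real_of_int p * ?\<rho> + ?\<rho>"
    using card_roots_upto_approx[of p "real_of_int X" "[:1, M:]"] \<open>0 < p\<close> \<open>0 \<le> X\<close> by linarith
  also have "\<dots> \<le> real_of_int X / real_of_int p * 1 + 1"
    using \<open>?\<rho> \<le> 1\<close> \<open>0 < p\<close> \<open>0 \<le> X\<close> by (intro add_mono mult_left_mono) auto
  finally show ?thesis by (simp add: mult.commute)
qed

text \<open>Along the progression \<open>1 + M k\<close> only primes exceeding \<open>K\<close> occur as factors.\<close>

lemma sum_prime_factor_reciprocals_le: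
  fixes K M X :: int
  assumes "0 < K" "0 < M" "0 \<le> X" and M: "\<And>p. prime p \<Longrightarrow> p \<le> K \<Longrightarrow> p dvd M"
  shows "(\<Sum>k=1..X. \<Sum>p\<in>prime_factors (1 + M * k). 1 / real_of_int p) \<le>
    real_of_int X / real_of_int K + 1 + ln (real_of_int (1 + M * X))"
proof -
  define Q where "Q = 1 + M * X"
  define A where "A = {p \<in> {K<..Q}. prime p \<and> \<not> p dvd M}"
  have "finite A" by (rule finite_subset[of _ "{K<..Q}"]) (auto simp: A_def)
  have factors: "prime_factors (1 + M * k) = {p. p \<in> A \<and> p dvd 1 + M * k}" if k: "k \<in> {1..X}" for k
  proof -
    have "0 < 1 + M * k" "1 + M * k \<le> Q" using k \<open>0 < M\<close> by (auto simp: Q_def add_pos_nonneg)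
    then have "p \<in> A" if "prime p" "p dvd 1 + M * k" for p
      using M[OF that(1)] not_dvd_if_dvd_one_plus_mult[OF that] that zdvd_imp_le[of p "1 + M * k"]
      by (fastforce simp: A_def)
    then show ?thesis using \<open>0 < 1 + M * k\<close> by (auto simp: A_def in_prime_factors_iff)
  qed
  have "(\<Sum>k=1..X. \<Sum>p\<in>prime_factors (1 + M * k). 1 / real_of_int p) =
      (\<Sum>k\<in>{1..X}. \<Sum>p | p \<in> A \<and> p dvd 1 + M * k. 1 / real_of_int p)"
    by (intro sum.cong refl factors)
  also have "\<dots> = (\<Sum>p\<in>A. \<Sum>k | k \<in> {1..X} \<and> p dvd 1 + M * k. 1 / real_of_int p)"
    by (rule sum.swap_restrict[OF _ \<open>finite A\<close>]) simp
  also have "\<dots> = (\<Sum>p\<in>A. real (card {k \<in> {1..X}. p dvd 1 + M * k}) * (1 / real_of_int p))"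
    by simp
  also have "\<dots> \<le> (\<Sum>p\<in>A. (real_of_int X / real_of_int p + 1) * (1 / real_of_int p))"
    using \<open>0 < K\<close> \<open>0 \<le> X\<close>
    by (intro sum_mono mult_right_mono card_prime_dvd_progression_le) (auto simp: A_def)
  also have "\<dots> = real_of_int X * (\<Sum>p\<in>A. 1 / (real_of_int p)\<^sup>2) + (\<Sum>p\<in>A. 1 / real_of_int p)"
    by (simp add: algebra_simps sum.distrib sum_distrib_left power2_eq_square)
  also have "\<dots> \<le> real_of_int X * (\<Sum>m\<in>{K<..Q}. 1 / (real_of_int m)\<^sup>2) + (\<Sum>m=1..Q. 1 / real_of_int m)"
    using \<open>0 < K\<close> \<open>0 \<le> X\<close> by (intro add_mono mult_left_mono sum_mono2) (auto simp: A_def)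
  also have "\<dots> \<le> real_of_int X * (1 / real_of_int K) + (1 + ln (real_of_int Q))"
    using \<open>0 < K\<close> \<open>0 < M\<close> \<open>0 \<le> X\<close>
    by (intro add_mono mult_left_mono sum_inverse_squares_le sum_inverse_le_ln) (auto simp: Q_def)
  finally show ?thesis by (simp add: Q_def)
qed

lemma card_reduced_pairs_mono: "Q \<le> Q' \<Longrightarrow> card (reduced_pairs P Q \<alpha>) \<le> card (reduced_pairs P Q' \<alpha>)"
  unfolding card_reduced_pairs by (intro sum_mono2) auto

lemma square_le_two_mult_sum:
  fixes X :: int
  assumes "0 \<le> X"
  shows "(real_of_int X)\<^sup>2 \<le> 2 * (\<Sum>k=1..X. real_of_int k)"
  using assms
proof (induction X rule: int_ge_induct)
  case (step X)
  have "{1..X + 1} = insert (X + 1) {1..X}" using step.hyps by auto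
  then show ?case using step.IH by (simp add: power2_eq_square algebra_simps)
qed simp

lemma card_reduced_pairs_progression_ge:
  fixes K M X :: int and Q :: real
  assumes "0 < K" "0 < M" "0 \<le> X"
    and M: "\<And>p. prime p \<Longrightarrow> p \<le> K \<Longrightarrow> p dvd M" and lc: "lead_coeff P dvd M"
  defines "Q \<equiv> real_of_int (1 + M * X)"
  shows "M * (real_of_int X)\<^sup>2 / 2 - degree P * Q * (X / K + 1 + ln Q)
    \<le> card (reduced_pairs P (1 + M * X) 1)"
proof -
  define f where "f k = 1 + M * k" for k
  define \<sigma> where "\<sigma> k = (\<Sum>p\<in>prime_factors (f k). 1 / real_of_int p)" for k
  have \<sigma>_nonneg: "0 \<le> \<sigma> k" for k
    unfolding \<sigma>_def by (intro sum_nonneg) (auto simp: prime_ge_0_int)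
  have f: "0 < f k" "f k \<le> Q" "f k \<in> {1..1 + M * X}" if "k \<in> {1..X}" for k
    using that \<open>0 < M\<close> by (auto simp: f_def Q_def add_pos_nonneg)
  have ge: "f k - degree P * Q * \<sigma> k \<le> card (reduced_numerators P (f k) (f k))"
    if k: "k \<in> {1..X}" for k
  proof -
    have "\<not> p dvd lead_coeff P" if "p \<in> prime_factors (f k)" for p
      using that not_dvd_if_dvd_one_plus_mult[of p M k] lc by (auto simp: f_def intro: dvd_trans)
    then have "f k - degree P * real_of_int (f k) * \<sigma> k \<le> card (reduced_numerators P (f k) (f k))"
      unfolding \<sigma>_def using f(1)[OF k] by (intro card_reduced_numerators_ge)
    moreover have "degree P * real_of_int (f k) * \<sigma> k \<le> degree P * Q * \<sigma> k"
      using f(2)[OF k] \<sigma>_nonneg by (intro mult_right_mono mult_left_mono) auto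
    ultimately show ?thesis by linarith
  qed
  have "M * (real_of_int X)\<^sup>2 / 2 \<le> M * (\<Sum>k=1..X. real_of_int k)"
    using square_le_two_mult_sum[OF \<open>0 \<le> X\<close>] \<open>0 < M\<close> by (simp add: field_simps)
  also have "\<dots> \<le> (\<Sum>k=1..X. real_of_int (f k))"
    unfolding sum_distrib_left by (intro sum_mono) (simp add: f_def)
  finally have main: "M * (real_of_int X)\<^sup>2 / 2 \<le> (\<Sum>k=1..X. real_of_int (f k))" .
  have "degree P * Q * (\<Sum>k=1..X. \<sigma> k) \<le> degree P * Q * (X / K + 1 + ln Q)"
    unfolding \<sigma>_def f_def Q_def using assms
    by (intro mult_left_mono sum_prime_factor_reciprocals_le) auto
  with main have "M * (real_of_int X)\<^sup>2 / 2 - degree P * Q * (X / K + 1 + ln Q) \<le>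
      (\<Sum>k=1..X. f k - degree P * Q * \<sigma> k)"
    by (simp add: sum_subtractf sum_distrib_left)
  also have "\<dots> \<le> (\<Sum>k=1..X. real (card (reduced_numerators P (f k) (f k))))"
    by (intro sum_mono ge)
  also have "\<dots> = (\<Sum>q\<in>f ` {1..X}. real (card (reduced_numerators P q q)))"
    using \<open>0 < M\<close> by (subst sum.reindex) (auto simp: inj_on_def f_def)
  also have "\<dots> \<le> (\<Sum>q=1..1 + M * X. real (card (reduced_numerators P q q)))"
    using f(3) by (intro sum_mono2) auto
  finally show ?thesis by (simp add: card_reduced_pairs)
qed

lemma ex_multiple_of_small_primes:
  fixes c K :: int
  assumes "c \<noteq> 0"
  obtains M where "0 < M" "c dvd M" "\<And>p. prime p \<Longrightarrow> p \<le> K \<Longrightarrow> p dvd M"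
proof
  show "0 < \<bar>c\<bar> * fact (nat K)" using assms by simp
  show "c dvd \<bar>c\<bar> * fact (nat K)" by simp
  fix p :: int assume p: "prime p" "p \<le> K"
  then have "1 < p" by (simp add: prime_gt_1_int)
  then have "int (nat p) dvd int (fact (nat K))"
    unfolding int_dvd_int_iff using p by (intro dvd_fact) auto
  then show "p dvd \<bar>c\<bar> * fact (nat K)" using \<open>1 < p\<close> by (simp add: of_nat_fact)
qed

lemma card_reduced_pairs_progression_ge_quadratic:
  assumes "P \<noteq> 0"
  shows "\<exists>M>0. \<exists>c>0. \<exists>B. \<forall>X\<ge>0. B \<le> real_of_int X \<longrightarrow>
    c * (real_of_int X)\<^sup>2 \<le> card (reduced_pairs P (1 + M * X) 1)"
proof -
  define n where "n = real (degree P + 1)"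
  define K where "K = 4 * int (degree P + 1)"
  obtain M where M: "0 < M" "lead_coeff P dvd M" "\<And>p. prime p \<Longrightarrow> p \<le> K \<Longrightarrow> p dvd M"
    using ex_multiple_of_small_primes[of "lead_coeff P" K] assms by auto
  define m where "m = real_of_int M"
  have "0 < m" "0 < n" using M(1) by (simp_all add: m_def n_def)
  then have "eventually (\<lambda>x. m / 8 * x\<^sup>2 \<le>
      m * x\<^sup>2 / 2 - (x + m * x\<^sup>2) / 4 - n * (1 + m * x) * (1 + ln (1 + m * x))) at_top"
    by real_asymp
  then obtain B where B: "m / 8 * x\<^sup>2 \<le>
      m * x\<^sup>2 / 2 - (x + m * x\<^sup>2) / 4 - n * (1 + m * x) * (1 + ln (1 + m * x))" if "B \<le> x" for x
    by (auto simp: eventually_at_top_linorder)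
  have "m / 8 * (real_of_int X)\<^sup>2 \<le> card (reduced_pairs P (1 + M * X) 1)"
    if "B \<le> X" "0 \<le> X" for X
  proof -
    define Q where "Q = 1 + m * X"
    have "1 \<le> Q" using \<open>0 < m\<close> \<open>0 \<le> X\<close> by (simp add: Q_def)
    have "m * (real_of_int X)\<^sup>2 / 2 - degree P * Q * (X / K + 1 + ln Q) \<le>
        card (reduced_pairs P (1 + M * X) 1)"
      using card_reduced_pairs_progression_ge[of K M X P] M \<open>0 \<le> X\<close> by (simp add: Q_def m_def K_def)
    moreover have "degree P * Q * (X / K + 1 + ln Q) \<le> n * Q * (X / K + 1 + ln Q)"
      using \<open>1 \<le> Q\<close> \<open>0 \<le> X\<close> by (intro mult_right_mono) (auto simp: n_def K_def)
    moreover have "n * Q * (X / K + 1 + ln Q) = (X + m * (real_of_int X)\<^sup>2) / 4 + n * Q * (1 + ln Q)"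
      by (simp add: n_def K_def Q_def field_simps power2_eq_square)
    ultimately show ?thesis using B[OF \<open>B \<le> X\<close>] unfolding Q_def by linarith
  qed
  then show ?thesis
    using M(1) \<open>0 < m\<close> by (intro exI[of _ M] conjI exI[of _ "m / 8"] exI[of _ B]) auto
qed

lemma quadratic_lower_bound_if_along_progression:
  fixes f :: "int \<Rightarrow> real"
  assumes mono: "\<And>Q Q'. Q \<le> Q' \<Longrightarrow> f Q \<le> f Q'" and "0 < f 1" and "0 < M" "0 < c"
    and ge: "\<And>X. 0 \<le> X \<Longrightarrow> B \<le> real_of_int X \<Longrightarrow> c * (real_of_int X)\<^sup>2 \<le> f (1 + M * X)"
  shows "\<exists>c>0. \<forall>Q\<ge>1. c * (real_of_int Q)\<^sup>2 \<le> f Q"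
proof -
  define m where "m = real_of_int M"
  define L where "L = m * (max B 1 + 1)"
  have "0 < m" using \<open>0 < M\<close> by (simp add: m_def)
  then have "0 < L" by (simp add: L_def)
  have "min (c / (4 * m\<^sup>2)) (f 1 / L\<^sup>2) * (real_of_int Q)\<^sup>2 \<le> f Q" if "1 \<le> Q" for Q
  proof -
    define X where "X = (Q - 1) div M"
    have "0 \<le> X" using \<open>1 \<le> Q\<close> \<open>0 < M\<close> by (simp add: X_def pos_imp_zdiv_nonneg_iff)
    have "Q - 1 = M * X + (Q - 1) mod M" by (simp add: X_def)
    then have X: "1 + M * X \<le> Q" "Q \<le> M * (X + 1)"
      using pos_mod_sign[OF \<open>0 < M\<close>, of "Q - 1"] pos_mod_bound[OF \<open>0 < M\<close>, of "Q - 1"]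
      by (simp_all add: algebra_simps)
    have "real_of_int Q \<le> real_of_int (M * (X + 1))" using X(2) by (simp only: of_int_le_iff)
    then have Q_le: "real_of_int Q \<le> m * (real_of_int X + 1)" by (simp add: m_def)
    show ?thesis
    proof (cases "max B 1 \<le> X")
      case True
      then have "m * (real_of_int X + 1) \<le> m * (2 * X)" using \<open>0 < m\<close> by (intro mult_left_mono) auto
      with Q_le have "(real_of_int Q)\<^sup>2 \<le> (m * (2 * X))\<^sup>2" using \<open>1 \<le> Q\<close> by (intro power_mono) auto
      then have "c / (4 * m\<^sup>2) * (real_of_int Q)\<^sup>2 \<le> c / (4 * m\<^sup>2) * (m * (2 * X))\<^sup>2"
        using \<open>0 < c\<close> by (intro mult_left_mono) auto
      also have "\<dots> = c * (real_of_int X)\<^sup>2" using \<open>0 < m\<close> by (simp add: field_simps)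
      also have "\<dots> \<le> f (1 + M * X)" using ge True \<open>0 \<le> X\<close> by simp
      also have "\<dots> \<le> f Q" by (rule mono[OF X(1)])
      finally show ?thesis by (simp add: min_mult_distrib_right min.coboundedI1)
    next
      case False
      then have "m * (real_of_int X + 1) \<le> L"
        unfolding L_def using \<open>0 < m\<close> by (intro mult_left_mono) auto
      with Q_le have "(real_of_int Q)\<^sup>2 \<le> L\<^sup>2" using \<open>1 \<le> Q\<close> by (intro power_mono) auto
      then have "f 1 / L\<^sup>2 * (real_of_int Q)\<^sup>2 \<le> f 1 / L\<^sup>2 * L\<^sup>2"
        using \<open>0 < f 1\<close> by (intro mult_left_mono) auto
      also have "\<dots> \<le> f Q" using mono[OF \<open>1 \<le> Q\<close>] \<open>0 < L\<close> by simp
      finally show ?thesis by (simp add: min_mult_distrib_right min.coboundedI2)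
    qed
  qed
  moreover have "0 < min (c / (4 * m\<^sup>2)) (f 1 / L\<^sup>2)"
    using \<open>0 < m\<close> \<open>0 < L\<close> \<open>0 < c\<close> \<open>0 < f 1\<close> by simp
  ultimately show ?thesis by (intro exI[of _ "min (c / (4 * m\<^sup>2)) (f 1 / L\<^sup>2)"]) blast
qed

lemma card_reduced_pairs_ge:
  assumes "P \<noteq> 0"
  shows "\<exists>c>0. \<forall>Q\<ge>1. c * (real_of_int Q)\<^sup>2 \<le> card (reduced_pairs P Q 1)"
proof -
  obtain M c B where "0 < M" "0 < c" and ge: "\<And>X. 0 \<le> X \<Longrightarrow> B \<le> real_of_int X \<Longrightarrow>
      c * (real_of_int X)\<^sup>2 \<le> card (reduced_pairs P (1 + M * X) 1)"
    using card_reduced_pairs_progression_ge_quadratic[OF assms] by blast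
  have "reduced_numerators P 1 1 = {1}" by (auto simp: reduced_numerators_def)
  then have "0 < real (card (reduced_pairs P 1 1))" by (simp add: card_reduced_pairs)
  then show ?thesis
    using card_reduced_pairs_mono \<open>0 < M\<close> \<open>0 < c\<close> ge
    by (intro quadratic_lower_bound_if_along_progression[where M = M and c = c and B = B]) auto
qed

section \<open>Discrepancy of the polynomial Farey fractions\<close>

lemma discrepancy_ge:
  assumes "finite S" "0 \<le> \<alpha>" "\<alpha> \<le> 1"
  shows "\<bar>real (card {x \<in> S. x \<le> \<alpha>}) / real (card S) - \<alpha>\<bar> \<le> discrepancy S"
  unfolding discrepancy_def
proof (rule cSUP_upper)
  show "bdd_above ((\<lambda>\<alpha>. \<bar>real (card {x \<in> S. x \<le> \<alpha>}) / real (card S) - \<alpha>\<bar>) ` {0..1})"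
  proof (rule bdd_aboveI2)
    fix \<beta> :: real assume \<beta>: "\<beta> \<in> {0..1}"
    have "card {x \<in> S. x \<le> \<beta>} \<le> card S" using assms(1) by (intro card_mono) auto
    then have "real (card {x \<in> S. x \<le> \<beta>}) / real (card S) \<le> 1"
      by (cases "card S = 0") (auto simp: divide_le_eq_1)
    moreover have "0 \<le> real (card {x \<in> S. x \<le> \<beta>}) / real (card S)" by simp
    ultimately show "\<bar>real (card {x \<in> S. x \<le> \<beta>}) / real (card S) - \<beta>\<bar> \<le> 1"
      using \<beta> unfolding atLeastAtMost_iff by linarith
  qed
qed (use assms in auto)

lemma discrepancy_ge_if_all_greater:
  assumes "finite S" "0 \<le> \<alpha>" "\<alpha> \<le> 1" and "\<And>x. x \<in> S \<Longrightarrow> \<alpha> < x"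
  shows "\<alpha> \<le> discrepancy S"
proof -
  have none: "{x \<in> S. x \<le> \<alpha>} = {}" using assms(4) by force
  show ?thesis using discrepancy_ge[OF assms(1-3)] assms(2) unfolding none by simp
qed

lemma discrepancy_le:
  assumes "0 < card S"
    and le: "\<And>\<alpha>. 0 \<le> \<alpha> \<Longrightarrow> \<alpha> \<le> 1 \<Longrightarrow> \<bar>real (card {x \<in> S. x \<le> \<alpha>}) - \<alpha> * real (card S)\<bar> \<le> B"
  shows "discrepancy S \<le> B / real (card S)"
  unfolding discrepancy_def
proof (rule cSUP_least)
  fix \<alpha> :: real assume "\<alpha> \<in> {0..1}"
  have "real (card {x \<in> S. x \<le> \<alpha>}) / real (card S) - \<alpha> =
      (real (card {x \<in> S. x \<le> \<alpha>}) - \<alpha> * real (card S)) / real (card S)"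
    using assms(1) by (simp add: diff_divide_distrib)
  then show "\<bar>real (card {x \<in> S. x \<le> \<alpha>}) / real (card S) - \<alpha>\<bar> \<le> B / real (card S)"
    using le[of \<alpha>] \<open>\<alpha> \<in> {0..1}\<close> by (simp add: divide_right_mono)
qed simp

lemma finite_poly_farey: "finite (poly_farey P Q)"
proof (rule finite_subset)
  show "poly_farey P Q \<subseteq> (\<lambda>(a, q). real a / real q) ` ({..Q} \<times> {..Q})"
    by (force simp: poly_farey_def)
qed simp

definition fraction :: "int \<times> int \<Rightarrow> real" where
  "fraction = (\<lambda>(q, a). real_of_int a / real_of_int q)"

text \<open>Because \<open>P(0) = 0\<close>, \<open>a\<close> divides \<open>P(a)\<close>, so the fractions are in lowest terms.\<close>

lemma inj_on_fraction_reduced_pairs: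
  assumes "poly P 0 = 0"
  shows "inj_on fraction (reduced_pairs P Q \<alpha>)"
proof (rule inj_onI, clarify)
  fix q a q' a' assume qa: "(q, a) \<in> reduced_pairs P Q \<alpha>" "(q', a') \<in> reduced_pairs P Q \<alpha>"
    and eq: "fraction (q, a) = fraction (q', a')"
  then have pos: "0 < q" "0 < q'"
    and coprime: "coprime (poly P a) q" "coprime (poly P a') q'"
    by (auto simp: reduced_pairs_def reduced_numerators_def)
  have "x dvd poly P x" for x using diff_dvd_poly_diff[of x 0 P] assms by simp
  with coprime have "coprime a q" "coprime a' q'" by (meson coprime_divisors dvd_refl)+
  have "real_of_int (a * q') = real_of_int (a' * q)"
    using eq pos by (simp add: fraction_def field_simps)
  then have cross: "a * q' = a' * q" by (simp only: of_int_eq_iff)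
  then have "q dvd a * q'" "q' dvd a' * q" by (simp, simp flip: cross)
  then have "q dvd q'" "q' dvd q"
    using \<open>coprime a q\<close> \<open>coprime a' q'\<close> by (simp_all add: coprime_dvd_mult_right_iff coprime_commute)
  then have "q = q'" using pos by (simp add: zdvd_antisym_nonneg)
  with cross pos show "q = q' \<and> a = a'" by simp
qed

lemma fraction_image_reduced_pairs:
  assumes "0 \<le> \<alpha>" "\<alpha> \<le> 1"
  shows "fraction ` reduced_pairs P (int Q) \<alpha> = {x \<in> poly_farey P Q. x \<le> \<alpha>}"
proof (intro subset_antisym image_subsetI subsetI)
  fix s assume "s \<in> reduced_pairs P (int Q) \<alpha>"
  moreover obtain q a where s: "s = (q, a)" by force
  ultimately have q: "1 \<le> q" "q \<le> int Q" and a: "1 \<le> a" "real_of_int a \<le> \<alpha> * real_of_int q"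
    and coprime: "coprime (poly P a) q"
    by (auto simp: reduced_pairs_def reduced_numerators_def le_floor_iff)
  have "\<alpha> * real_of_int q \<le> real_of_int q" using q assms by (intro mult_left_le_one_le) auto
  with a(2) have "real_of_int a \<le> real_of_int q" by linarith
  then have "fraction s = real (nat a) / real (nat q) \<and> 1 \<le> nat a \<and> nat a \<le> nat q \<and> nat q \<le> Q \<and>
      gcd (poly P (int (nat a))) (int (nat q)) = 1"
    using q a(1) coprime by (simp add: s fraction_def coprime_iff_gcd_eq_1 nat_mono nat_le_iff)
  then have "fraction s \<in> poly_farey P Q" 
    unfolding poly_farey_def by (intro CollectI exI)
  then show "fraction s \<in> {x \<in> poly_farey P Q. x \<le> \<alpha>}"
    using a(2) q by (simp add: s fraction_def field_simps)
next
  fix x assume x: "x \<in> {x \<in> poly_farey P Q. x \<le> \<alpha>}"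
  then obtain a q where aq: "x = real a / real q" "1 \<le> a" "a \<le> q" "q \<le> Q"
    "gcd (poly P (int a)) (int q) = 1"
    by (auto simp: poly_farey_def)
  have "real a \<le> \<alpha> * real q" using x aq by (simp add: field_simps)
  then have "(int q, int a) \<in> reduced_pairs P (int Q) \<alpha>"
    using aq by (simp add: reduced_pairs_def reduced_numerators_def le_floor_iff coprime_iff_gcd_eq_1)
  moreover have "x = fraction (int q, int a)" using aq by (simp add: fraction_def)
  ultimately show "x \<in> fraction ` reduced_pairs P (int Q) \<alpha>" by blast
qed

lemma card_poly_farey_le:
  assumes "poly P 0 = 0" "0 \<le> \<alpha>" "\<alpha> \<le> 1"
  shows "card {x \<in> poly_farey P Q. x \<le> \<alpha>} = card (reduced_pairs P (int Q) \<alpha>)"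
  using fraction_image_reduced_pairs[OF assms(2,3), of P Q]
    card_image[OF inj_on_fraction_reduced_pairs[OF assms(1)], of "int Q" \<alpha>] by simp

lemma card_poly_farey:
  assumes "poly P 0 = 0"
  shows "card (poly_farey P Q) = card (reduced_pairs P (int Q) 1)"
proof -
  have "x \<le> 1" if "x \<in> poly_farey P Q" for x using that by (auto simp: poly_farey_def)
  then have "{x \<in> poly_farey P Q. x \<le> 1} = poly_farey P Q" by blast
  with card_poly_farey_le[OF assms, of 1 Q] show ?thesis by simp
qed

lemma discrepancy_poly_farey_ge:
  assumes "1 \<le> Q"
  shows "1 / 2 * (1 / real Q) \<le> discrepancy (poly_farey P Q)"
proof (rule discrepancy_ge_if_all_greater[OF finite_poly_farey])
  fix x assume "x \<in> poly_farey P Q"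
  then obtain a q where aq: "x = real a / real q" "1 \<le> a" "a \<le> q" "q \<le> Q"
    by (auto simp: poly_farey_def)
  have "1 / 2 * (1 / real Q) < 1 / real Q" using assms by (simp add: field_simps)
  also have "\<dots> \<le> real a / real q" using aq by (intro frac_le) auto
  finally show "1 / 2 * (1 / real Q) < x" using aq(1) by simp
qed (use assms in \<open>auto simp: field_simps\<close>)

lemma discrepancy_poly_farey_le:
  assumes "P \<noteq> 0" "poly P 0 = 0"
  shows "\<exists>C>0. \<forall>Q\<ge>2. discrepancy (poly_farey P Q) \<le>
    C * (ln (real Q) ^ num_irreducible_factors P / real Q)"
proof -
  define J where "J = num_irreducible_factors P"
  obtain C where C: "0 \<le> C" "\<And>Q. 2 \<le> Q \<Longrightarrow> root_sum P Q \<le> C * ln (real_of_int Q) ^ J"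
    using root_sum_le_ln_power[OF assms(1)] unfolding J_def by blast
  obtain c where c: "0 < c" "\<And>Q. 1 \<le> Q \<Longrightarrow> c * (real_of_int Q)\<^sup>2 \<le> card (reduced_pairs P Q 1)"
    using card_reduced_pairs_ge[OF assms(1)] by blast
  have "discrepancy (poly_farey P Q) \<le> (C + 1) / c * (ln (real Q) ^ J / real Q)" if "2 \<le> Q" for Q
  proof -
    let ?N = "real (card (poly_farey P Q))"
    have N: "c * (real Q)\<^sup>2 \<le> ?N"
      using c(2)[of "int Q"] \<open>2 \<le> Q\<close> by (simp add: card_poly_farey[OF assms(2)])
    moreover have "0 < c * (real Q)\<^sup>2" using c(1) \<open>2 \<le> Q\<close> by simp
    ultimately have "0 < ?N" by linarith
    have "\<bar>real (card {x \<in> poly_farey P Q. x \<le> \<alpha>}) - \<alpha> * ?N\<bar> \<le> real Q * root_sum P (int Q)"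
      if "0 \<le> \<alpha>" "\<alpha> \<le> 1" for \<alpha>
      using reduced_pairs_equidistributed[of "int Q" \<alpha> P] that
      by (simp add: card_poly_farey_le[OF assms(2)] card_poly_farey[OF assms(2)])
    then have "discrepancy (poly_farey P Q) \<le> real Q * root_sum P (int Q) / ?N"
      using \<open>0 < ?N\<close> by (intro discrepancy_le) auto
    also have "\<dots> \<le> real Q * ((C + 1) * ln (real Q) ^ J) / (c * (real Q)\<^sup>2)"
    proof (intro frac_le mult_left_mono)
      have "root_sum P (int Q) \<le> C * ln (real Q) ^ J" using C(2)[of "int Q"] \<open>2 \<le> Q\<close> by simp
      also have "\<dots> \<le> (C + 1) * ln (real Q) ^ J" using \<open>2 \<le> Q\<close> by (intro mult_right_mono) auto
      finally show "root_sum P (int Q) \<le> (C + 1) * ln (real Q) ^ J" .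
    qed (use N \<open>0 < c * (real Q)\<^sup>2\<close> C(1) \<open>2 \<le> Q\<close> in auto)
    also have "\<dots> = (C + 1) / c * (ln (real Q) ^ J / real Q)"
      using \<open>2 \<le> Q\<close> c(1) by (simp add: field_simps power2_eq_square)
    finally show ?thesis .
  qed
  moreover have "0 < (C + 1) / c" using C(1) c(1) by simp
  ultimately show ?thesis unfolding J_def by blast
qed

theorem theorem1p1:
  fixes \<nu> J :: nat and c :: "nat \<Rightarrow> int" and P :: "int poly"
  assumes "\<nu> \<ge> 2"
    and "\<exists>i\<in>{1..\<nu>}. c i \<noteq> 0"
    and "P = (\<Sum>i=1..\<nu>. monom (c i) i)"
    and "discriminant P \<noteq> 0"
    and "J = num_irreducible_factors P"
  shows "\<exists>C\<^sub>1 > 0. \<exists>C\<^sub>2 > 0.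
           (\<forall>Q::nat. Q \<ge> 1 \<longrightarrow> C\<^sub>1 * (1 / real Q) \<le> discrepancy (poly_farey P Q)) \<and>
           (\<forall>Q::nat. Q \<ge> 2 \<longrightarrow> discrepancy (poly_farey P Q) \<le> C\<^sub>2 * (ln (real Q) ^ J / real Q))"
proof -
  have "coeff P i = (if i \<in> {1..\<nu>} then c i else 0)" for i
    unfolding assms(3) coeff_sum by (simp add: sum.delta)
  then have "P \<noteq> 0" using assms(2) by (metis coeff_0)
  moreover have "poly P 0 = 0" by (simp add: assms(3) poly_sum poly_monom zero_power)
  ultimately obtain C where "0 < C"
    "\<forall>Q\<ge>2. discrepancy (poly_farey P Q) \<le> C * (ln (real Q) ^ J / real Q)"
    using discrepancy_poly_farey_le unfolding assms(5) by blast
  then show ?thesis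
    using discrepancy_poly_farey_ge[of _ P]
    by (intro exI[of _ "1 / 2 :: real"] conjI exI[of _ C]) auto
qed

end
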